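(* Let $n,p$ be positive integers and let $\mathcal{A},\mathcal{B}\in\mathbb{H}^{n\times n\times p}_{++}$ have frontal slices $A^{(1)},\dots,A^{(p)}$ and $B^{(1)},\dots,B^{(p)}$ respectively. Let $\omega=e^{2\pi i/p}$ and for each $j=1,\dots,p$ put $$A_j=\sum_{k=1}^p\omega^{(j-1)(k-1)}A^{(k)},\qquad B_j=\sum_{k=1}^p\omega^{(j-1)(k-1)}B^{(k)}.$$ Then $$\mathcal{A}\#\mathcal{B}=\operatorname{bcirc}^{-1}\Big((\mathbf{F}_p^H\otimes I_n)\cdot\operatorname{diag}(A_1\#B_1,\dots,A_p\#B_p)\cdot(\mathbf{F}_p\otimes I_n)\Big).$$
   Context: A tensor $\mathcal{A}\in\mathbb{C}^{m\times n\times p}$ has frontal slices $A^{(1)},\dots,A^{(p)}\in\mathbb{C}^{m\times n}$. $\operatorname{bcirc}(\mathcal{A})\in\mathbb{C}^{mp\times np}$ is the block circulant matrix whose $(j,l)$ block is $A^{(((j-l)\bmod p)+1)}$ (first block column $A^{(1)},\dots,A^{(p)}$), and $\operatorname{bcirc}^{-1}$ is the inverse of the map $\operatorname{bcirc}$ on block circulant matrices; $\operatorname{unfold}(\mathcal{A})$ is the block column $A^{(1)},\dots,A^{(p)}$, and $\operatorname{fold}$ is its inverse. The T-product is $\mathcal{A}*\mathcal{B}=\operatorname{fold}(\operatorname{bcirc}(\mathcal{A})\cdot\operatorname{unfold}(\mathcal{B}))$. The identity tensor $\mathcal{I}_{n,p}$ has first frontal slice $I_n$ and all others zero; inverses are taken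 with respect to $*$ and $\mathcal{I}_{n,p}$. The T-conjugate transpose $\mathcal{A}^H$ has frontal slices $(A^{(1)})^H,(A^{(p)})^H,\dots,(A^{(2)})^H$, in this order. $\mathbb{H}^{n\times n\times p}$ is the set of T-Hermitian tensors, i.e. $\mathcal{A}\in\mathbb{C}^{n\times n\times p}$ with $\mathcal{A}^H=\mathcal{A}$. With $\langle\mathcal{A},\mathcal{B}\rangle=\sum_{i,j,k}\overline{a_{ijk}}b_{ijk}$, a tensor $\mathcal{A}\in\mathbb{H}^{n\times n\times p}$ is T-positive definite if $\langle\mathcal{X},\mathcal{A}*\mathcal{X}\rangle>0$ for all nonzero $\mathcal{X}\in\mathbb{C}^{n\times1\times p}$ (equivalently, $\operatorname{bcirc}(\mathcal{A})$ is Hermitian positive definite); $\mathbb{H}^{n\times n\times p}_{++}$ is the set of these. Each $\mathcal{A}\in\mathbb{H}^{n\times n\times p}_{++}$ is invertible and has a unique T-positive definite square root $\mathcal{A}^{1/2}$; $\mathcal{A}^{-1/2}=(\mathcal{A}^{1/2})^{-1}$. The geometric mean of tensors is $\mathcal{A}\#\mathcal{B}=\mathcal{A}^{1/2}*(\mathcal{A}^{-1/2}*\mathcal{B}*\mathcal{A}^{-1/2})^{1/2}*\mathcal{A}^{1/2}$. For Hermitian positive definite matrices $A,B$, $A\#B=A^{1/2}(A^{-1/2}BA^{-1/2})^{1/2}A^{1/2}$; the matrices $A_j,B_j$ in the claim are Hermitian positive definite. $\mathbf{F}_p\in\mathbb{C}^{p\times p}$ is the normalized DFT matrix with $(j,k)$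 entry $\frac{1}{\sqrt p}\omega^{(j-1)(k-1)}$; $\operatorname{diag}(\cdot)$ is the block diagonal matrix with the given diagonal blocks, and $\otimes$ is the Kronecker product. *)

theory Defs
  imports
    "Jordan_Normal_Form.Schur_Decomposition"
    "Jordan_Normal_Form.Gauss_Jordan_Elimination"
begin

section \<open>Matrices\<close>

text \<open>All row, column, block and slice indices start at 0. On complex numbers, \<open>0 < z\<close> means
  that \<open>z\<close> is real and positive. Since \<open>v \<bullet>c w\<close> conjugates its second argument, the inner product
  of \<open>v\<close> with \<open>A v\<close> that is conjugate-linear in \<open>v\<close> is \<open>(A *\<^sub>v v) \<bullet>c v\<close>.\<close>

definition hermitian_mats :: "nat \<Rightarrow> complex mat set" where
  "hermitian_mats n = {A \<in> carrier_mat n n. mat_adjoint A = A}"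

definition pos_def_mats :: "nat \<Rightarrow> complex mat set" where
  "pos_def_mats n = {A \<in> hermitian_mats n.
     \<forall>v \<in> carrier_vec n. v \<noteq> 0\<^sub>v n \<longrightarrow> 0 < (A *\<^sub>v v) \<bullet>c v}"

text \<open>The descriptions below are meaningful only for positive definite (square root) and
  invertible (inverse) arguments.\<close>

definition mat_inv :: "complex mat \<Rightarrow> complex mat" where
  "mat_inv A = the (mat_inverse A)"

definition mat_sqrt :: "complex mat \<Rightarrow> complex mat" where
  "mat_sqrt A = (THE S. S \<in> pos_def_mats (dim_row A) \<and> S * S = A)"

definition mat_geometric_mean :: "complex mat \<Rightarrow> complex mat \<Rightarrow> complex mat" (infixl "#\<^sub>m" 70) where
  "A #\<^sub>m B = mat_sqrt A
     * mat_sqrt (mat_inv (mat_sqrt A) * B * mat_inv (mat_sqrt A))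
     * mat_sqrt A"

definition kronecker :: "complex mat \<Rightarrow> complex mat \<Rightarrow> complex mat" (infixl "\<otimes>\<^sub>m" 75) where
  "A \<otimes>\<^sub>m B = mat (dim_row A * dim_row B) (dim_col A * dim_col B)
     (\<lambda>(i, j). A $$ (i div dim_row B, j div dim_col B) * B $$ (i mod dim_row B, j mod dim_col B))"

definition root_of_unity :: "nat \<Rightarrow> complex" where
  "root_of_unity p = exp (2 * of_real pi * \<i> / of_nat p)"

definition dft_mat :: "nat \<Rightarrow> complex mat" where
  "dft_mat p = mat p p (\<lambda>(j, k). 1 / of_real (sqrt (real p)) * root_of_unity p ^ (j * k))"


section \<open>Third-order tensors\<close>

text \<open>An \<open>m \<times> n \<times> p\<close> tensor is the list of its \<open>p\<close> frontal slices, all of which are \<open>m \<times> n\<close>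
  matrices; its entry at \<open>(i, j, k)\<close> is \<open>\<A> ! k $$ (i, j)\<close>. The dimensions \<open>m\<close> and \<open>n\<close> are read
  off the first slice, so the operations are intended for \<open>p > 0\<close>.\<close>

type_synonym tensor = "complex mat list"

definition tensors :: "nat \<Rightarrow> nat \<Rightarrow> nat \<Rightarrow> tensor set" where
  "tensors m n p = {\<A>. length \<A> = p \<and> set \<A> \<subseteq> carrier_mat m n}"

abbreviation tensor_rows :: "tensor \<Rightarrow> nat" where
  "tensor_rows \<A> \<equiv> dim_row (\<A> ! 0)"

abbreviation tensor_cols :: "tensor \<Rightarrow> nat" where
  "tensor_cols \<A> \<equiv> dim_col (\<A> ! 0)"

definition zero_tensor :: "nat \<Rightarrow> nat \<Rightarrow> nat \<Rightarrow> tensor" where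
  "zero_tensor m n p = replicate p (0\<^sub>m m n)"

definition id_tensor :: "nat \<Rightarrow> nat \<Rightarrow> tensor" where
  "id_tensor n p = map (\<lambda>k. if k = 0 then 1\<^sub>m n else 0\<^sub>m n n) [0..<p]"

text \<open>Block \<open>(j, l)\<close> is slice \<open>(j - l) mod p\<close>; adding \<open>p\<close> first avoids truncated subtraction.\<close>

definition bcirc :: "tensor \<Rightarrow> complex mat" where
  "bcirc \<A> = (let m = tensor_rows \<A>; n = tensor_cols \<A>; p = length \<A> in
     mat (m * p) (n * p)
       (\<lambda>(i, j). \<A> ! ((i div m + p - j div n) mod p) $$ (i mod m, j mod n)))"

text \<open>The matrix alone does not determine the block size, hence the dimension arguments. The
  value is meaningful only for matrices in \<open>bcirc ` tensors m n p\<close>, i.e. block circulant ones.\<close>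

definition bcirc_inv :: "nat \<Rightarrow> nat \<Rightarrow> nat \<Rightarrow> complex mat \<Rightarrow> tensor" where
  "bcirc_inv m n p = the_inv_into (tensors m n p) bcirc"

definition t_unfold :: "tensor \<Rightarrow> complex mat" where
  "t_unfold \<A> = (let m = tensor_rows \<A> in
     mat (m * length \<A>) (tensor_cols \<A>) (\<lambda>(i, j). \<A> ! (i div m) $$ (i mod m, j)))"

definition t_fold :: "nat \<Rightarrow> complex mat \<Rightarrow> tensor" where
  "t_fold p M = (let m = dim_row M div p in
     map (\<lambda>k. mat m (dim_col M) (\<lambda>(i, j). M $$ (k * m + i, j))) [0..<p])"

definition t_product :: "tensor \<Rightarrow> tensor \<Rightarrow> tensor" (infixl "\<star>" 70) where
  "\<A> \<star> \<B> = t_fold (length \<A>) (bcirc \<A> * t_unfold \<B>)"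

definition t_adjoint :: "tensor \<Rightarrow> tensor" where
  "t_adjoint \<A> = (let p = length \<A> in
     map (\<lambda>k. mat_adjoint (\<A> ! ((p - k) mod p))) [0..<p])"

definition tensor_inner :: "tensor \<Rightarrow> tensor \<Rightarrow> complex" where
  "tensor_inner \<A> \<B> = (\<Sum>k<length \<A>. \<Sum>i<tensor_rows \<A>. \<Sum>j<tensor_cols \<A>.
     cnj (\<A> ! k $$ (i, j)) * \<B> ! k $$ (i, j))"

definition t_hermitian :: "nat \<Rightarrow> nat \<Rightarrow> tensor set" where
  "t_hermitian n p = {\<A> \<in> tensors n n p. t_adjoint \<A> = \<A>}"

definition t_pos_def :: "nat \<Rightarrow> nat \<Rightarrow> tensor set" where
  "t_pos_def n p = {\<A> \<in> t_hermitian n p.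
     \<forall>\<X> \<in> tensors n 1 p. \<X> \<noteq> zero_tensor n 1 p \<longrightarrow> 0 < tensor_inner \<X> (\<A> \<star> \<X>)}"

definition t_inv :: "tensor \<Rightarrow> tensor" where
  "t_inv \<A> = (let n = tensor_rows \<A>; p = length \<A> in
     THE \<B>. \<B> \<in> tensors n n p \<and> \<A> \<star> \<B> = id_tensor n p \<and> \<B> \<star> \<A> = id_tensor n p)"

definition t_sqrt :: "tensor \<Rightarrow> tensor" where
  "t_sqrt \<A> = (THE \<S>. \<S> \<in> t_pos_def (tensor_rows \<A>) (length \<A>) \<and> \<S> \<star> \<S> = \<A>)"

definition t_geometric_mean :: "tensor \<Rightarrow> tensor \<Rightarrow> tensor" (infixl "#\<^sub>t" 70) where
  "\<A> #\<^sub>t \<B> = t_sqrt \<A>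
     \<star> t_sqrt (t_inv (t_sqrt \<A>) \<star> \<B> \<star> t_inv (t_sqrt \<A>))
     \<star> t_sqrt \<A>"

text \<open>\<open>\<Sum>\<^sub>k \<omega>\<^sup>j\<^sup>k \<A>\<^sub>k\<close>, written entrywise because matrices of varying dimension do not form
  an additive monoid.\<close>

definition fourier_slice :: "tensor \<Rightarrow> nat \<Rightarrow> complex mat" where
  "fourier_slice \<A> j = mat (tensor_rows \<A>) (tensor_cols \<A>)
     (\<lambda>(r, s). \<Sum>k<length \<A>. root_of_unity (length \<A>) ^ (j * k) * \<A> ! k $$ (r, s))"


section \<open>Consistency of the conversions\<close>

lemma tensors_nth: "\<A> \<in> tensors m n p \<Longrightarrow> k < p \<Longrightarrow> \<A> ! k \<in> carrier_mat m n"
  by (auto simp: tensors_def)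

lemma block_index_less:
  fixes i k m p :: nat
  assumes "k < p" "i < m"
  shows "k * m + i < m * p"
proof -
  have "k * m + i < Suc k * m" using assms by simp
  also have "\<dots> \<le> p * m" using assms by (intro mult_le_mono1) simp
  finally show ?thesis by (simp add: mult.commute)
qed

lemma t_fold_t_unfold:
  assumes "\<A> \<in> tensors m n p" "p > 0"
  shows "t_fold p (t_unfold \<A>) = \<A>"
proof (rule nth_equalityI)
  have len: "length \<A> = p" using assms by (simp add: tensors_def)
  show "length (t_fold p (t_unfold \<A>)) = length \<A>" by (simp add: t_fold_def Let_def len)
  fix k assume "k < length (t_fold p (t_unfold \<A>))"
  then have k: "k < p" by (simp add: t_fold_def Let_def)
  have c: "\<A> ! 0 \<in> carrier_mat m n" "\<A> ! k \<in> carrier_mat m n"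
    using tensors_nth assms k by auto
  show "t_fold p (t_unfold \<A>) ! k = \<A> ! k"
    by (rule eq_matI)
      (use c k len assms in \<open>auto simp: t_fold_def t_unfold_def Let_def block_index_less\<close>)
qed

lemma t_unfold_t_fold:
  assumes "M \<in> carrier_mat (m * p) n" "p > 0"
  shows "t_unfold (t_fold p M) = M"
proof (rule eq_matI)
  fix i j assume ij: "i < dim_row M" "j < dim_col M"
  then have "i < m * p" using assms by simp
  moreover from this have "m > 0" by (cases m) auto
  ultimately have "i div m < p" "i mod m < m"
    by (auto simp: less_mult_imp_div_less mult.commute)
  then show "t_unfold (t_fold p M) $$ (i, j) = M $$ (i, j)"
    using assms ij by (auto simp: t_unfold_def t_fold_def Let_def)
qed (use assms in \<open>auto simp: t_unfold_def t_fold_def Let_def\<close>)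

lemma inj_on_bcirc: "inj_on bcirc (tensors m n p)"
proof (rule inj_onI)
  fix \<A> \<B> assume AB: "\<A> \<in> tensors m n p" "\<B> \<in> tensors m n p" and eq: "bcirc \<A> = bcirc \<B>"
  have len: "length \<A> = p" "length \<B> = p" using AB by (auto simp: tensors_def)
  show "\<A> = \<B>"
  proof (rule nth_equalityI)
    show "length \<A> = length \<B>" using len by simp
    fix k assume "k < length \<A>"
    then have k: "k < p" using len by simp
    then have p: "0 < p" by simp
    have c: "\<A> ! 0 \<in> carrier_mat m n" "\<A> ! k \<in> carrier_mat m n"
        "\<B> ! 0 \<in> carrier_mat m n" "\<B> ! k \<in> carrier_mat m n"
      using tensors_nth AB k p by auto
    show "\<A> ! k = \<B> ! k"
    proof (rule eq_matI)
      fix i j assume "i < dim_row (\<B> ! k)" "j < dim_col (\<B> ! k)"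
      then have ij: "i < m" "j < n" using c by auto
      have "j < n * p" using ij p block_index_less[of 0 p j n] by simp
      then show "\<A> ! k $$ (i, j) = \<B> ! k $$ (i, j)"
        using arg_cong[OF eq, of "\<lambda>M. M $$ (k * m + i, j)"] c ij k len
          block_index_less[OF k ij(1)]
        by (simp add: bcirc_def Let_def)
    qed (use c in auto)
  qed
qed

end

theory Submission
  imports Defs "Jordan_Normal_Form.Spectral_Radius"
begin

text \<open>
  The discrete Fourier transform along the third mode replaces a tensor by the family of its Fourier
  slices \<open>A\<^sub>j = \<Sum>\<^sub>k \<omega>\<^sup>j\<^sup>k A\<^sup>(\<^sup>k\<^sup>)\<close>.  The slices of a T-product are cyclic convolutions, and Fourier turns
  convolution into multiplication, so the transform carries \<open>\<star>\<close> to the matrix product in every slice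
  (\<open>fourier_slice_t_product\<close>).  It also carries the T-conjugate transpose to the adjoint and the identity tensor
  to identity matrices, and it is a bijection onto families of \<open>p\<close> matrices (Fourier inversion).  By
  Parseval, a tensor is T-positive definite iff all its Fourier slices are positive definite
  (\<open>t_pos_def_iff_fourier\<close>).

  Hence everything that is characterised by these notions is computed slice by slice: square roots
  (\<open>t_sqrt_fourier\<close>), inverses (\<open>t_inv_fourier\<close>) and finally the geometric mean, whose Fourier slices are
  the means of the slices (\<open>t_geometric_mean_fourier\<close>).  The claim is then the block
  diagonalisation \<open>bcirc \<A> = (F\<^sup>H \<otimes> I) diag (A\<^sub>0, \<dots>, A\<^bsub>p-1\<^esub>) (F \<otimes> I)\<close> (\<open>bcirc_fourier\<close>), applied to the
  geometric mean.

  Square roots are defined by a unique description, so for matrices their existence and uniqueness are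
  needed.  Both follow from the spectral theorem for Hermitian matrices
  (\<open>hermitian_unitary_diagonalization\<close>), proved by splitting off one eigenvector at a time.
\<close>

section \<open>The discrete Fourier transform\<close>

lemma root_of_unity_power: "root_of_unity p ^ k = cis (2 * pi * real k / real p)"
proof -
  have "root_of_unity p = cis (2 * pi / real p)"
    unfolding root_of_unity_def cis_conv_exp by (simp add: mult_ac)
  then show ?thesis by (simp add: DeMoivre mult_ac)
qed

lemma cnj_root_of_unity_power_mult: "cnj (root_of_unity p ^ k) * root_of_unity p ^ k = 1"
  unfolding root_of_unity_power by (simp add: cis_cnj cis_mult)

lemma root_of_unity_power_period:
  assumes "p > 0" shows "root_of_unity p ^ p = 1"
  unfolding root_of_unity_power using assms by simp

lemma root_of_unity_power_cong:
  assumes "p > 0" "a mod p = b mod p"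
  shows "root_of_unity p ^ a = root_of_unity p ^ b"
proof -
  have "root_of_unity p ^ c = root_of_unity p ^ (c mod p)" for c
  proof -
    have "root_of_unity p ^ c = root_of_unity p ^ (p * (c div p) + c mod p)" by simp
    also have "\<dots> = root_of_unity p ^ (c mod p)"
      using root_of_unity_power_period[OF assms(1)] by (simp only: power_add power_mult) simp
    finally show ?thesis .
  qed
  then show ?thesis using assms(2) by metis
qed

lemma root_of_unity_power_inject:
  assumes "k < p" "l < p" "root_of_unity p ^ k = root_of_unity p ^ l"
  shows "k = l"
proof -
  have "inj_on (\<lambda>k. cis (2 * pi * real k / real p)) {..<p}"
    using bij_betw_roots_unity[of p] assms(1) by (auto simp: bij_betw_def)
  then show ?thesis using assms unfolding root_of_unity_power by (auto dest: inj_onD)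
qed

text \<open>The terms are the powers of \<open>z = \<omega>\<^sup>l\<^sup>-\<^sup>k\<close>, a \<open>p\<close>-th root of unity that is 1 only for \<open>k = l\<close>;
  otherwise the geometric sum \<open>(z\<^sup>p - 1) / (z - 1)\<close> vanishes.\<close>
lemma root_of_unity_orthogonality:
  assumes "k < p" "l < p"
  shows "(\<Sum>j<p. cnj (root_of_unity p ^ (j * k)) * root_of_unity p ^ (j * l))
    = (if k = l then of_nat p else 0)"
proof -
  let ?w = "root_of_unity p"
  define z where "z = cnj (?w ^ k) * ?w ^ l"
  have p: "p > 0" using assms by simp
  have pow: "cnj (?w ^ (j * k)) * ?w ^ (j * l) = z ^ j" for j
    unfolding z_def by (simp add: power_mult_distrib power_mult[symmetric] mult.commute)
  show ?thesis
  proof (cases "k = l")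
    case True
    then show ?thesis using cnj_root_of_unity_power_mult by simp
  next
    case False
    have "z \<noteq> 1"
    proof
      assume "z = 1"
      then have "?w ^ k = ?w ^ k * z" by simp
      also have "\<dots> = ?w ^ l"
        using cnj_root_of_unity_power_mult[of p k] unfolding z_def
        by (simp add: mult.assoc[symmetric] mult.commute)
      finally show False using root_of_unity_power_inject assms False by blast
    qed
    moreover have "z ^ p = 1"
    proof -
      have "z ^ p = cnj ((?w ^ p) ^ k) * (?w ^ p) ^ l"
        unfolding z_def by (simp add: power_mult_distrib power_mult[symmetric] mult.commute)
      then show ?thesis using root_of_unity_power_period[OF p] by simp
    qed
    ultimately show ?thesis using False unfolding pow
      by (simp add: sum_gp_strict)
  qed
qed

definition dft :: "nat \<Rightarrow> (nat \<Rightarrow> complex) \<Rightarrow> nat \<Rightarrow> complex" where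
  "dft p f j = (\<Sum>k<p. root_of_unity p ^ (j * k) * f k)"

definition inverse_dft :: "nat \<Rightarrow> (nat \<Rightarrow> complex) \<Rightarrow> nat \<Rightarrow> complex" where
  "inverse_dft p g k = (\<Sum>j<p. cnj (root_of_unity p ^ (j * k)) * g j) / of_nat p"

lemma inverse_dft_dft:
  assumes "k < p"
  shows "inverse_dft p (dft p f) k = f k"
proof -
  let ?w = "root_of_unity p"
  have "(\<Sum>j<p. cnj (?w ^ (j * k)) * dft p f j)
      = (\<Sum>j<p. \<Sum>l<p. (cnj (?w ^ (j * k)) * ?w ^ (j * l)) * f l)"
    unfolding dft_def sum_distrib_left by (simp only: mult.assoc)
  also have "\<dots> = (\<Sum>l<p. (\<Sum>j<p. cnj (?w ^ (j * k)) * ?w ^ (j * l)) * f l)"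
    unfolding sum_distrib_right by (rule sum.swap)
  also have "\<dots> = (\<Sum>l<p. (if k = l then of_nat p else 0) * f l)"
    by (intro sum.cong refl, subst root_of_unity_orthogonality) (use assms in auto)
  also have "\<dots> = of_nat p * f k"
    using assms by (simp add: if_distrib[of "\<lambda>x. x * _"] cong: if_cong)
  finally show ?thesis unfolding inverse_dft_def using assms by simp
qed

lemma dft_inverse_dft:
  assumes "j < p"
  shows "dft p (inverse_dft p g) j = g j"
proof -
  let ?w = "root_of_unity p"
  have sw: "?w ^ (j * k) * cnj (?w ^ (i * k)) = cnj (?w ^ (k * i)) * ?w ^ (k * j)" for i k
    by (simp only: mult.commute)
  have "of_nat p * dft p (inverse_dft p g) j
      = (\<Sum>k<p. \<Sum>i<p. (?w ^ (j * k) * cnj (?w ^ (i * k))) * g i)"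
  proof -
    have p: "of_nat p * inverse_dft p g k = (\<Sum>i<p. cnj (?w ^ (i * k)) * g i)" for k
      using assms by (simp add: inverse_dft_def)
    have "of_nat p * dft p (inverse_dft p g) j
        = (\<Sum>k<p. ?w ^ (j * k) * (of_nat p * inverse_dft p g k))"
      unfolding dft_def sum_distrib_left by (simp only: mult_ac)
    then show ?thesis unfolding p sum_distrib_left by (simp only: mult.assoc)
  qed
  also have "\<dots> = (\<Sum>i<p. (\<Sum>k<p. cnj (?w ^ (k * i)) * ?w ^ (k * j)) * g i)"
    unfolding sum_distrib_right sw by (rule sum.swap)
  also have "\<dots> = (\<Sum>i<p. (if i = j then of_nat p else 0) * g i)"
    by (intro sum.cong refl, subst root_of_unity_orthogonality) (use assms in auto)
  also have "\<dots> = of_nat p * g j"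
    using assms by (simp add: if_distrib[of "\<lambda>x. x * _"] cong: if_cong)
  finally show ?thesis using assms by simp
qed

text \<open>Expanding only \<open>dft p f j\<close> leaves, for each \<open>k\<close>, the inverse transform of \<open>dft p g\<close>; the factor \<open>p\<close>
  comes from leaving \<open>dft\<close> unnormalised.\<close>
lemma dft_parseval:
  "(\<Sum>j<p. cnj (dft p f j) * dft p g j) = of_nat p * (\<Sum>k<p. cnj (f k) * g k)"
proof -
  let ?w = "root_of_unity p"
  have "(\<Sum>j<p. cnj (dft p f j) * dft p g j)
      = (\<Sum>j<p. \<Sum>k<p. cnj (f k) * (cnj (?w ^ (j * k)) * dft p g j))"
    unfolding dft_def[of p f] cnj_sum sum_distrib_right complex_cnj_mult
    by (simp only: mult_ac)
  also have "\<dots> = (\<Sum>k<p. cnj (f k) * (\<Sum>j<p. cnj (?w ^ (j * k)) * dft p g j))"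
    unfolding sum_distrib_left by (rule sum.swap)
  also have "\<dots> = (\<Sum>k<p. cnj (f k) * (of_nat p * g k))"
  proof (intro sum.cong refl)
    fix k assume "k \<in> {..<p}"
    then show "cnj (f k) * (\<Sum>j<p. cnj (?w ^ (j * k)) * dft p g j) = cnj (f k) * (of_nat p * g k)"
      using inverse_dft_dft[of k p g] by (simp add: inverse_dft_def field_simps)
  qed
  finally show ?thesis by (simp add: sum_distrib_left mult_ac)
qed

lemma mod_shift_inverse:
  fixes k l p :: nat
  assumes "k < p" "l < p"
  shows "((k + p - l) mod p + l) mod p = k" "((k + l) mod p + p - l) mod p = k"
proof -
  show "((k + p - l) mod p + l) mod p = k" using assms by (simp add: mod_simps)
  have "((k + l) mod p + p - l) mod p = ((k + l) mod p + (p - l)) mod p" using assms by simp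
  also have "\<dots> = (k + l + (p - l)) mod p" by (simp only: mod_simps)
  also have "\<dots> = k" using assms by simp
  finally show "((k + l) mod p + p - l) mod p = k" .
qed

lemma sum_cyclic_shift:
  fixes p l :: nat
  assumes "l < p"
  shows "(\<Sum>k<p. h k ((k + p - l) mod p)) = (\<Sum>k<p. h ((k + l) mod p) k)"
  by (rule sum.reindex_bij_witness[where i = "\<lambda>k. (k + l) mod p" and j = "\<lambda>k. (k + p - l) mod p"])
    (use assms mod_shift_inverse in auto)

text \<open>The frontal slices of a T-product are cyclic convolutions of frontal slices, so this is what
  makes the Fourier transform multiplicative: shifting \<open>f\<close> by \<open>l\<close> multiplies its transform by
  \<open>\<omega>\<^sup>j\<^sup>l\<close>.\<close>
lemma dft_cyclic_convolution:
  "dft p (\<lambda>k. \<Sum>l<p. f ((k + p - l) mod p) * g l) j = dft p f j * dft p g j"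
proof -
  let ?w = "root_of_unity p"
  have "dft p (\<lambda>k. \<Sum>l<p. f ((k + p - l) mod p) * g l) j
      = (\<Sum>l<p. (\<Sum>k<p. ?w ^ (j * k) * f ((k + p - l) mod p)) * g l)"
    unfolding dft_def sum_distrib_left sum_distrib_right
    by (subst sum.swap) (simp only: mult.assoc)
  also have "\<dots> = (\<Sum>l<p. dft p f j * (?w ^ (j * l) * g l))"
  proof (intro sum.cong refl)
    fix l assume l: "l \<in> {..<p}"
    have pw: "?w ^ (j * ((k + l) mod p)) = ?w ^ (j * l) * ?w ^ (j * k)" for k
    proof -
      have "?w ^ (j * ((k + l) mod p)) = ?w ^ (j * (k + l))"
        using l by (intro root_of_unity_power_cong) (auto simp: mod_mult_right_eq)
      then show ?thesis by (simp add: power_add distrib_left mult.commute)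
    qed
    have "(\<Sum>k<p. ?w ^ (j * k) * f ((k + p - l) mod p))
        = (\<Sum>k<p. ?w ^ (j * ((k + l) mod p)) * f k)"
      using sum_cyclic_shift[of l p "\<lambda>a b. ?w ^ (j * a) * f b"] l by simp
    also have "\<dots> = ?w ^ (j * l) * dft p f j"
      unfolding pw dft_def by (simp add: sum_distrib_left mult_ac)
    finally show "(\<Sum>k<p. ?w ^ (j * k) * f ((k + p - l) mod p)) * g l
        = dft p f j * (?w ^ (j * l) * g l)" by simp
  qed
  finally show ?thesis by (simp add: dft_def[of p g] sum_distrib_left)
qed

text \<open>The T-conjugate transpose reverses the slices modulo \<open>p\<close>; conjugating \<open>\<omega>\<close> undoes the reversal.\<close>
lemma dft_reversed_cnj:
  "dft p (\<lambda>k. cnj (f ((p - k) mod p))) j = cnj (dft p f j)"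
proof -
  let ?w = "root_of_unity p"
  have inv: "(p - (p - k) mod p) mod p = k" if "k < p" for k
    using that by (cases "k = 0") auto
  have "(\<Sum>k<p. ?w ^ (j * k) * cnj (f ((p - k) mod p)))
      = (\<Sum>k<p. ?w ^ (j * ((p - k) mod p)) * cnj (f k))"
    by (rule sum.reindex_bij_witness[where i = "\<lambda>k. (p - k) mod p" and j = "\<lambda>k. (p - k) mod p"])
      (use inv in auto)
  also have "\<dots> = (\<Sum>k<p. cnj (?w ^ (j * k)) * cnj (f k))"
  proof (intro sum.cong refl arg_cong2[where f = "(*)"])
    fix k assume "k \<in> {..<p}"
    then have k: "k < p" by simp
    have "?w ^ (j * ((p - k) mod p)) * ?w ^ (j * k) = ?w ^ (j * ((p - k) mod p + k))"
      by (simp add: power_add distrib_left)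
    also have "\<dots> = ?w ^ 0"
    proof (rule root_of_unity_power_cong)
      have "((p - k) mod p + k) mod p = 0" using k by (simp add: mod_simps)
      then show "j * ((p - k) mod p + k) mod p = 0 mod p" by (metis mod_mult_right_eq mult_0_right)
    qed (use k in simp)
    finally have "?w ^ (j * ((p - k) mod p)) * ?w ^ (j * k) = 1" by simp
    then have "cnj (?w ^ (j * k)) = (?w ^ (j * ((p - k) mod p)) * ?w ^ (j * k)) * cnj (?w ^ (j * k))"
      by simp
    also have "\<dots> = ?w ^ (j * ((p - k) mod p))"
      using cnj_root_of_unity_power_mult[of p "j * k"] by (simp only: mult_ac) simp
    finally show "?w ^ (j * ((p - k) mod p)) = cnj (?w ^ (j * k))" by simp
  qed
  finally show ?thesis unfolding dft_def by (simp add: cnj_sum)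
qed

section \<open>Positive definite matrices\<close>

lemma dim_mat_adjoint [simp]:
  "dim_row (mat_adjoint A) = dim_col A" "dim_col (mat_adjoint A) = dim_row A"
  by (auto simp: mat_adjoint_def)

lemma mat_adjoint_carrier [simp, intro]:
  "A \<in> carrier_mat m n \<Longrightarrow> mat_adjoint A \<in> carrier_mat n m"
  by (intro carrier_matI) auto

lemma index_mat_adjoint [simp]:
  "i < dim_col A \<Longrightarrow> j < dim_row A \<Longrightarrow> mat_adjoint A $$ (i, j) = conjugate (A $$ (j, i))"
  by (auto simp: mat_adjoint_def mat_of_rows_def)

lemma mat_adjoint_mat_adjoint [simp]: "mat_adjoint (mat_adjoint A) = A"
  by (rule eq_matI) auto

lemma mat_adjoint_mult:
  fixes A B :: "complex mat"
  assumes "A \<in> carrier_mat m n" "B \<in> carrier_mat n q"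
  shows "mat_adjoint (A * B) = mat_adjoint B * mat_adjoint A"
  by (rule eq_matI) (use assms in \<open>auto simp: scalar_prod_def cnj_sum mult.commute\<close>)

lemma cscalar_prod_adjoint:
  fixes A :: "complex mat"
  assumes "A \<in> carrier_mat m n" "v \<in> carrier_vec n" "w \<in> carrier_vec m"
  shows "(A *\<^sub>v v) \<bullet>c w = v \<bullet>c (mat_adjoint A *\<^sub>v w)"
proof -
  have "(A *\<^sub>v v) \<bullet>c w = (\<Sum>i<m. \<Sum>j<n. A $$ (i, j) * v $ j * cnj (w $ i))"
    using assms by (auto simp: scalar_prod_def sum_distrib_right lessThan_atLeast0)
  also have "\<dots> = (\<Sum>j<n. \<Sum>i<m. A $$ (i, j) * v $ j * cnj (w $ i))" by (rule sum.swap)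
  also have "\<dots> = v \<bullet>c (mat_adjoint A *\<^sub>v w)"
    using assms by (auto simp: scalar_prod_def sum_distrib_left cnj_sum lessThan_atLeast0 mult_ac
        intro!: sum.cong)
  finally show ?thesis .
qed

lemma pos_def_matsD:
  assumes "A \<in> pos_def_mats n"
  shows "A \<in> carrier_mat n n" "mat_adjoint A = A"
    "v \<in> carrier_vec n \<Longrightarrow> v \<noteq> 0\<^sub>v n \<Longrightarrow> 0 < (A *\<^sub>v v) \<bullet>c v"
  using assms by (auto simp: pos_def_mats_def hermitian_mats_def)

lemma pos_def_matsI:
  assumes "A \<in> carrier_mat n n" "mat_adjoint A = A"
    "\<And>v. v \<in> carrier_vec n \<Longrightarrow> v \<noteq> 0\<^sub>v n \<Longrightarrow> 0 < (A *\<^sub>v v) \<bullet>c v"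
  shows "A \<in> pos_def_mats n"
  using assms by (auto simp: pos_def_mats_def hermitian_mats_def)

text \<open>The left inverse \<open>D\<close> keeps \<open>C v\<close> nonzero, and \<open>\<langle>v, C\<^sup>H A C v\<rangle> = \<langle>C v, A (C v)\<rangle>\<close>.\<close>
lemma pos_def_mats_congruence:
  assumes A: "A \<in> pos_def_mats n" and C: "C \<in> carrier_mat n n" and D: "D \<in> carrier_mat n n"
    and DC: "D * C = 1\<^sub>m n"
  shows "mat_adjoint C * A * C \<in> pos_def_mats n"
proof (rule pos_def_matsI)
  note Ac = pos_def_matsD[OF A]
  show "mat_adjoint C * A * C \<in> carrier_mat n n" using Ac C by auto
  show "mat_adjoint (mat_adjoint C * A * C) = mat_adjoint C * A * C"
    using Ac C by (simp add: mat_adjoint_mult[of _ n n _ n] assoc_mult_mat[of _ n n _ n _ n] mult_carrier_mat[of _ n n _ n])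
  fix v :: "complex vec" assume v: "v \<in> carrier_vec n" "v \<noteq> 0\<^sub>v n"
  have "C *\<^sub>v v \<noteq> 0\<^sub>v n"
  proof
    assume "C *\<^sub>v v = 0\<^sub>v n"
    then have "D *\<^sub>v (C *\<^sub>v v) = 0\<^sub>v n" using D by auto
    then show False
      using v C D DC assoc_mult_mat_vec[of D n n C n v] by simp
  qed
  then have "0 < (A *\<^sub>v (C *\<^sub>v v)) \<bullet>c (C *\<^sub>v v)" using Ac C v by auto
  also have "\<dots> = (mat_adjoint C *\<^sub>v (A *\<^sub>v (C *\<^sub>v v))) \<bullet>c v"
    using cscalar_prod_adjoint[of "mat_adjoint C" n n "A *\<^sub>v (C *\<^sub>v v)" v] Ac C v by auto
  also have "mat_adjoint C *\<^sub>v (A *\<^sub>v (C *\<^sub>v v)) = (mat_adjoint C * A * C) *\<^sub>v v"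
    using Ac(1) C v(1)
    by (simp add: assoc_mult_mat_vec[of _ n n _ n] mult_mat_vec_carrier[of _ n n] mult_carrier_mat[of _ n n _ n])
  finally show "0 < ((mat_adjoint C * A * C) *\<^sub>v v) \<bullet>c v" .
qed

text \<open>A positive definite matrix has trivial kernel.  The inverse is Hermitian because its adjoint is
  also an inverse.\<close>
lemma mat_inv_pos_def:
  assumes A: "A \<in> pos_def_mats n"
  shows "mat_inv A \<in> carrier_mat n n" "A * mat_inv A = 1\<^sub>m n" "mat_inv A * A = 1\<^sub>m n"
    "mat_adjoint (mat_inv A) = mat_inv A"
proof -
  note Ac = pos_def_matsD[OF A]
  have "det A \<noteq> 0"
  proof
    assume "det A = 0"
    then obtain v where v: "v \<in> carrier_vec n" "v \<noteq> 0\<^sub>v n" "A *\<^sub>v v = 0\<^sub>v n"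
      using det_0_iff_vec_prod_zero[OF Ac(1)] by auto
    then show False using Ac(3)[OF v(1,2)] by (simp add: carrier_vecD)
  qed
  then have "A \<in> Units (ring_mat TYPE(complex) n ())" by (rule det_non_zero_imp_unit[OF Ac(1)])
  then obtain B where "mat_inverse A = Some B"
    using mat_inverse(1)[OF Ac(1), where b = "()"] by (cases "mat_inverse A") auto
  then show inv: "mat_inv A \<in> carrier_mat n n" "A * mat_inv A = 1\<^sub>m n" "mat_inv A * A = 1\<^sub>m n"
    using mat_inverse(2)[OF Ac(1)] by (auto simp: mat_inv_def)
  have one: "mat_adjoint (1\<^sub>m n) = (1\<^sub>m n :: complex mat)" by (rule eq_matI) auto
  have "mat_adjoint (mat_inv A) * A = 1\<^sub>m n"
    using mat_adjoint_mult[OF Ac(1) inv(1)] Ac(2) inv(2) one by simp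
  then have "mat_adjoint (mat_inv A) * A * mat_inv A = mat_inv A" using inv(1) by simp
  then show "mat_adjoint (mat_inv A) = mat_inv A"
    using assoc_mult_mat[of "mat_adjoint (mat_inv A)" n n A n "mat_inv A" n] inv Ac by simp
qed

section \<open>Spectral theorem and square roots\<close>

text \<open>Complete \<open>v\<close> to a basis, orthogonalise by Gram-Schmidt, which leaves the first vector alone, and
  scale every vector to length 1.\<close>
lemma unitary_mat_first_col:
  fixes v :: "complex vec"
  assumes v: "v \<in> carrier_vec n" "v \<noteq> 0\<^sub>v n"
  obtains U c where "U \<in> carrier_mat n n" "mat_adjoint U * U = 1\<^sub>m n" "col U 0 = c \<cdot>\<^sub>v v"
proof -
  interpret cof_vec_space n "TYPE(complex)" .
  define b where "b = basis_completion v"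
  define ws where "ws = gram_schmidt n b"
  have n: "0 < n" using v by (cases n) auto
  have b: "set b \<subseteq> carrier_vec n" "distinct b" "\<not> lin_dep (set b)" "length b = n" "hd b = v"
    using basis_completion[OF v, folded b_def] by auto
  have ws: "set ws \<subseteq> carrier_vec n" "corthogonal ws" "length ws = n"
    using gram_schmidt_result[OF b(1-3) ws_def] b(4) by auto
  obtain vs where "b = v # vs" using b n by (cases b) auto
  then have hd: "ws ! 0 = v"
    using gram_schmidt_hd[OF v(1), of vs] ws(3) n unfolding ws_def by (metis hd_conv_nth length_greater_0_conv)
  define s where "s i = complex_of_real (1 / sqrt (Re (ws ! i \<bullet>c ws ! i)))" for i
  define U where "U = mat n n (\<lambda>(i, j). s j * (ws ! j) $ i)"
  have wsc: "ws ! i \<in> carrier_vec n" if "i < n" for i using ws that by (metis nth_mem subsetD)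
  have U: "U \<in> carrier_mat n n" by (simp add: U_def)
  have "mat_adjoint U * U = 1\<^sub>m n"
  proof (rule eq_matI)
    fix i j assume "i < dim_row (1\<^sub>m n :: complex mat)" "j < dim_col (1\<^sub>m n :: complex mat)"
    then have ij: "i < n" "j < n" by auto
    have "(mat_adjoint U * U) $$ (i, j) = (\<Sum>k<n. cnj (s i * (ws ! i) $ k) * (s j * (ws ! j) $ k))"
      using ij by (simp add: U_def scalar_prod_def lessThan_atLeast0)
    also have "\<dots> = cnj (s i) * s j * (ws ! j \<bullet>c ws ! i)"
      using wsc[OF ij(1)] wsc[OF ij(2)]
      by (simp add: scalar_prod_def lessThan_atLeast0 sum_distrib_left mult_ac)
    also have "\<dots> = (if i = j then 1 else 0)"
    proof (cases "i = j")
      case False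
      then show ?thesis using ws ij by (auto dest: corthogonalD)
    next
      case True
      have "0 \<le> ws ! i \<bullet>c ws ! i" by auto
      moreover have "ws ! i \<bullet>c ws ! i \<noteq> 0" using corthogonalD[OF ws(2), of i i] ij ws(3) by auto
      ultimately obtain r where r: "ws ! i \<bullet>c ws ! i = complex_of_real r" "r > 0"
        by (metis complex_eq_iff Im_complex_of_real Re_complex_of_real less_eq_complex_def
            order_le_less zero_complex.sel)
      have "cnj (s i) * s i * complex_of_real r = complex_of_real (1 / sqrt r * (1 / sqrt r) * r)"
        unfolding s_def r Re_complex_of_real complex_cnj_complex_of_real of_real_mult ..
      also have "1 / sqrt r * (1 / sqrt r) * r = 1" using r(2) by (simp add: field_simps)
      finally show ?thesis using True r by simp
    qed
    finally show "(mat_adjoint U * U) $$ (i, j) = 1\<^sub>m n $$ (i, j)" using ij by simp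
  qed (use U in auto)
  moreover have "col U 0 = s 0 \<cdot>\<^sub>v v" using n v hd by (auto simp: U_def)
  ultimately show ?thesis using that U by blast
qed

definition diagonal :: "nat \<Rightarrow> (nat \<Rightarrow> complex) \<Rightarrow> complex mat" where
  "diagonal n d = mat n n (\<lambda>(i, j). if i = j then d i else 0)"

lemma diagonal_carrier [simp, intro]: "diagonal n d \<in> carrier_mat n n"
  by (simp add: diagonal_def)

lemma dim_diagonal [simp]: "dim_row (diagonal n d) = n" "dim_col (diagonal n d) = n"
  by (simp_all add: diagonal_def)

text \<open>Induction on the dimension.  Let \<open>W\<close> be unitary with an eigenvector of \<open>A\<close> for the value \<open>e\<close> as
  first column.  Then the first column of \<open>B = W\<^sup>H A W\<close> is \<open>e\<close> followed by zeros, and its first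
  row has the same form because \<open>B\<close> is Hermitian.  The remaining block \<open>C\<close> is Hermitian, and a unitary \<open>V\<close> that
  diagonalises \<open>C\<close> gives \<open>W \<cdot> (1 \<oplus> V)\<close> for \<open>A\<close>.\<close>
theorem hermitian_unitary_diagonalization:
  assumes "A \<in> hermitian_mats n"
  obtains U d where "U \<in> carrier_mat n n" "mat_adjoint U * U = 1\<^sub>m n"
    "mat_adjoint U * A * U = diagonal n d"
proof -
  have "\<exists>U d. U \<in> carrier_mat n n \<and> mat_adjoint U * U = 1\<^sub>m n \<and> mat_adjoint U * A * U = diagonal n d"
    using assms
  proof (induction n arbitrary: A)
    case 0
    have "mat_adjoint (1\<^sub>m 0) * A * 1\<^sub>m 0 = diagonal 0 (\<lambda>_. 0)"
      by (rule eq_matI) (auto simp: diagonal_def)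
    moreover have "mat_adjoint (1\<^sub>m 0) * 1\<^sub>m 0 = (1\<^sub>m 0 :: complex mat)"
      by (rule eq_matI) auto
    ultimately show ?case by (intro exI[of _ "1\<^sub>m 0"] exI conjI) auto
  next
    case (Suc n)
    let ?N = "Suc n"
    have A: "A \<in> carrier_mat ?N ?N" "mat_adjoint A = A" using Suc.prems by (auto simp: hermitian_mats_def)
    obtain e where "eigenvalue A e" using spectrum_non_empty[OF A(1)] by (auto simp: spectrum_def)
    then obtain v where v: "v \<in> carrier_vec ?N" "v \<noteq> 0\<^sub>v ?N" "A *\<^sub>v v = e \<cdot>\<^sub>v v"
      using A by (auto simp: eigenvalue_def eigenvector_def)
    obtain W c where W: "W \<in> carrier_mat ?N ?N" "mat_adjoint W * W = 1\<^sub>m ?N" "col W 0 = c \<cdot>\<^sub>v v"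
      using unitary_mat_first_col[OF v(1,2)] .
    define B where "B = mat_adjoint W * A * W"
    have B: "B \<in> carrier_mat ?N ?N" using W A by (auto simp: B_def)
    have Bh: "mat_adjoint B = B"
      using A W by (simp add: B_def mat_adjoint_mult[of _ ?N ?N _ ?N] assoc_mult_mat[of _ ?N ?N _ ?N _ ?N] mult_carrier_mat[of _ ?N ?N _ ?N])
    have B0: "B $$ (i, 0) = (if i = 0 then e else 0)" if i: "i < ?N" for i
    proof -
      have "A *\<^sub>v col W 0 = e \<cdot>\<^sub>v col W 0"
        using v A(1) by (simp add: W(3) mult_mat_vec[of _ ?N ?N] smult_smult_assoc mult.commute)
      moreover have "col B 0 = mat_adjoint W *\<^sub>v (A *\<^sub>v col W 0)"
      proof -
        have "B = mat_adjoint W * (A * W)"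
          unfolding B_def by (rule assoc_mult_mat[OF mat_adjoint_carrier[OF W(1)] A(1) W(1)])
        then show ?thesis
          using col_mult2[OF mat_adjoint_carrier[OF W(1)] mult_carrier_mat[OF A(1) W(1)], of 0]
            col_mult2[OF A(1) W(1), of 0] by simp
      qed
      ultimately have "col B 0 = e \<cdot>\<^sub>v (mat_adjoint W *\<^sub>v col W 0)"
        using W(1) mult_mat_vec[of "mat_adjoint W" ?N ?N "col W 0" e] by auto
      also have "mat_adjoint W *\<^sub>v col W 0 = col (1\<^sub>m ?N) 0"
        using W by (metis col_mult2 mat_adjoint_carrier zero_less_Suc)
      finally have "col B 0 $ i = (e \<cdot>\<^sub>v col (1\<^sub>m ?N) 0) $ i" by simp
      then show ?thesis using i B by auto
    qed
    have B0': "B $$ (0, i) = (if i = 0 then e else 0)" if i: "i < ?N" for i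
    proof (cases "i = 0")
      case True then show ?thesis using B0 by simp
    next
      case False
      have "B $$ (0, i) = mat_adjoint B $$ (0, i)" using Bh by simp
      also have "\<dots> = cnj (B $$ (i, 0))" using B i by simp
      finally show ?thesis using B0 i False by simp
    qed
    define C where "C = mat n n (\<lambda>(i, j). B $$ (Suc i, Suc j))"
    have C: "C \<in> carrier_mat n n" by (simp add: C_def)
    have "mat_adjoint C = C"
    proof (rule eq_matI)
      fix i j assume "i < dim_row C" "j < dim_col C"
      then have ij: "i < n" "j < n" using C by auto
      have "cnj (B $$ (Suc j, Suc i)) = mat_adjoint B $$ (Suc i, Suc j)" using ij B by simp
      then show "mat_adjoint C $$ (i, j) = C $$ (i, j)" using ij Bh by (simp add: C_def)
    qed (use C in auto)
    then obtain V d where V: "V \<in> carrier_mat n n" "mat_adjoint V * V = 1\<^sub>m n"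
        "mat_adjoint V * C * V = diagonal n d"
      using Suc.IH[of C] C by (auto simp: hermitian_mats_def)
    define V' where "V' = four_block_mat (1\<^sub>m 1) (0\<^sub>m 1 n) (0\<^sub>m n 1) V"
    have V': "V' \<in> carrier_mat ?N ?N" using four_block_carrier_mat[of "1\<^sub>m 1" 1 1 V n n] V by (auto simp: V'_def)
    have adV': "mat_adjoint V' = four_block_mat (1\<^sub>m 1) (0\<^sub>m 1 n) (0\<^sub>m n 1) (mat_adjoint V)"
      by (rule eq_matI) (use V in \<open>auto simp: V'_def\<close>)
    have Bblock: "B = four_block_mat (mat 1 1 (\<lambda>_. e)) (0\<^sub>m 1 n) (0\<^sub>m n 1) C"
    proof (rule eq_matI)
      fix i j assume "i < dim_row (four_block_mat (mat 1 1 (\<lambda>_. e)) (0\<^sub>m 1 n) (0\<^sub>m n 1) C)"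
        "j < dim_col (four_block_mat (mat 1 1 (\<lambda>_. e)) (0\<^sub>m 1 n) (0\<^sub>m n 1) C)"
      then have ij: "i < ?N" "j < ?N" using C by auto
      then show "B $$ (i, j) = four_block_mat (mat 1 1 (\<lambda>_. e)) (0\<^sub>m 1 n) (0\<^sub>m n 1) C $$ (i, j)"
        using B0[of i] B0'[of j] C by (cases i; cases j) (auto simp: C_def)
    qed (use B C in auto)
    have mv: "mat_adjoint V' * V' = 1\<^sub>m ?N"
    proof -
      have "mat_adjoint V' * V' = four_block_mat (1\<^sub>m 1) (0\<^sub>m 1 n) (0\<^sub>m n 1) (1\<^sub>m n)"
        unfolding adV' unfolding V'_def
        by (subst mult_four_block_mat[of _ 1 1 _ n _ n _ _ 1 _ n]) (use V in auto)
      also have "\<dots> = 1\<^sub>m ?N" by (rule eq_matI) auto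
      finally show ?thesis .
    qed
    have mB: "mat_adjoint V' * B * V' = diagonal ?N (case_nat e d)"
    proof -
      have left: "mat_adjoint V' * B = four_block_mat (mat 1 1 (\<lambda>_. e)) (0\<^sub>m 1 n) (0\<^sub>m n 1) (mat_adjoint V * C)"
        unfolding adV' Bblock
        by (subst mult_four_block_mat[of _ 1 1 _ n _ n _ _ 1 _ n]) (use V C in auto)
      have "mat_adjoint V' * B * V'
          = four_block_mat (mat 1 1 (\<lambda>_. e)) (0\<^sub>m 1 n) (0\<^sub>m n 1) (diagonal n d)"
        unfolding left unfolding V'_def
        by (subst mult_four_block_mat[of _ 1 1 _ n _ n _ _ 1 _ n]) (use V C in auto)
      also have "\<dots> = diagonal ?N (case_nat e d)"
        by (rule eq_matI) (auto simp: diagonal_def split: nat.splits)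
      finally show ?thesis .
    qed
    show ?case
    proof (intro exI[of _ "W * V'"] exI[of _ "case_nat e d"] conjI)
      show "W * V' \<in> carrier_mat ?N ?N" using W V' by auto
      have ad: "mat_adjoint (W * V') = mat_adjoint V' * mat_adjoint W"
        by (rule mat_adjoint_mult[OF W(1) V'])
      have "mat_adjoint (W * V') * (W * V') = mat_adjoint V' * (mat_adjoint W * W) * V'"
        using W(1) V' by (simp add: ad assoc_mult_mat[of _ ?N ?N _ ?N _ ?N] mult_carrier_mat[of _ ?N ?N _ ?N])
      then show "mat_adjoint (W * V') * (W * V') = 1\<^sub>m ?N"
        using W V' mv by simp
      have "mat_adjoint (W * V') * A * (W * V') = mat_adjoint V' * B * V'"
        using W(1) V' A(1) by (simp add: B_def ad assoc_mult_mat[of _ ?N ?N _ ?N _ ?N] mult_carrier_mat[of _ ?N ?N _ ?N])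
      then show "mat_adjoint (W * V') * A * (W * V') = diagonal ?N (case_nat e d)"
        using mB by simp
    qed
  qed
  then show ?thesis using that by blast
qed

lemma diagonal_mult: "diagonal n d * diagonal n d' = diagonal n (\<lambda>i. d i * d' i)"
  by (rule eq_matI)
    (auto simp: diagonal_def scalar_prod_def if_distrib[of "\<lambda>x. x * _"] if_distrib[of "\<lambda>x. _ * x"] cong: if_cong)

lemma diagonal_pos_def:
  assumes "\<And>i. i < n \<Longrightarrow> 0 < d i"
  shows "diagonal n d \<in> pos_def_mats n"
proof (rule pos_def_matsI)
  have re: "cnj (d i) = d i" if "i < n" for i
    using assms[OF that] by (simp add: less_complex_def complex_eq_iff)
  show "mat_adjoint (diagonal n d) = diagonal n d"
    by (rule eq_matI) (auto simp: diagonal_def re)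
  fix v :: "complex vec" assume v: "v \<in> carrier_vec n" "v \<noteq> 0\<^sub>v n"
  have "(diagonal n d *\<^sub>v v) $ i = d i * v $ i" if "i < n" for i
    using that v by (simp add: diagonal_def scalar_prod_def if_distrib[of "\<lambda>x. x * _"] cong: if_cong)
  then have eq: "(diagonal n d *\<^sub>v v) \<bullet>c v = (\<Sum>i<n. d i * (v $ i * cnj (v $ i)))"
    using v by (simp add: scalar_prod_def lessThan_atLeast0 mult.assoc)
  obtain i where i: "i < n" "v $ i \<noteq> 0" using v by (metis eq_vecI index_zero_vec carrier_vecD)
  show "0 < (diagonal n d *\<^sub>v v) \<bullet>c v" unfolding eq
  proof (rule sum_pos2[of _ i])
    show "0 < d i * (v $ i * cnj (v $ i))"
      using assms[OF i(1)] i(2)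
      by (auto simp: complex_mult_cnj less_complex_def sum_power2_gt_zero_iff complex_eq_iff)
    show "0 \<le> d k * (v $ k * cnj (v $ k))" if "k \<in> {..<n}" for k
      using assms[of k] that by (auto simp: complex_mult_cnj less_eq_complex_def less_complex_def)
  qed (use i in auto)
qed auto

lemma pos_def_diag_entry:
  assumes A: "A \<in> pos_def_mats n" and i: "i < n"
  shows "0 < A $$ (i, i)"
proof -
  note Ac = pos_def_matsD[OF A]
  have "0 < (A *\<^sub>v unit_vec n i) \<bullet>c unit_vec n i" using Ac i by auto
  also have "conjugate (unit_vec n i :: complex vec) = unit_vec n i"
    by (rule eq_vecI) (auto simp: unit_vec_def)
  also have "(A *\<^sub>v unit_vec n i) \<bullet> unit_vec n i = A $$ (i, i)"
    using Ac(1) i by (simp add: scalar_prod_right_unit[of _ n])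
  finally show ?thesis .
qed

text \<open>With \<open>U\<^sup>H A U = diag d\<close>, congruence makes the entries of \<open>d\<close> positive, and \<open>U diag (\<surd>d) U\<^sup>H\<close> is the
  square root.\<close>
lemma pos_def_sqrt_exists:
  assumes A: "A \<in> pos_def_mats n"
  obtains S where "S \<in> pos_def_mats n" "S * S = A"
proof -
  note Ac = pos_def_matsD[OF A]
  obtain U d where U: "U \<in> carrier_mat n n" "mat_adjoint U * U = 1\<^sub>m n"
    and d: "mat_adjoint U * A * U = diagonal n d"
    using hermitian_unitary_diagonalization[of A n] A by (auto simp: pos_def_mats_def)
  note assoc = assoc_mult_mat[of _ n n _ n _ n] mult_carrier_mat[of _ n n _ n]
  have UU: "U * mat_adjoint U = 1\<^sub>m n"
    using mat_mult_left_right_inverse[OF mat_adjoint_carrier[OF U(1)] U(1,2)] .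
  have "diagonal n d \<in> pos_def_mats n"
    using pos_def_mats_congruence[OF A U(1) _ U(2)] U(1) d by auto
  then have dp: "0 < d i" if "i < n" for i
    using pos_def_diag_entry[OF _ that] that by (fastforce simp: diagonal_def)
  define r where "r i = complex_of_real (sqrt (Re (d i)))" for i
  have rr: "r i * r i = d i" if "i < n" for i
    using dp[OF that] by (auto simp: r_def less_complex_def complex_eq_iff)
  have R: "diagonal n r \<in> pos_def_mats n"
    using dp by (intro diagonal_pos_def) (auto simp: r_def less_complex_def)
  have RR: "diagonal n r * diagonal n r = diagonal n d"
    unfolding diagonal_mult by (rule eq_matI) (auto simp: diagonal_def rr)
  define S where "S = U * diagonal n r * mat_adjoint U"
  have "S \<in> pos_def_mats n"
    using pos_def_mats_congruence[OF R mat_adjoint_carrier[OF U(1)] U(1) UU] by (simp add: S_def)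
  moreover have "S * S = A"
  proof -
    have R: "diagonal n r \<in> carrier_mat n n" and U': "mat_adjoint U \<in> carrier_mat n n"
      using U(1) by auto
    have "S * S = U * diagonal n r * (mat_adjoint U * U) * diagonal n r * mat_adjoint U"
      unfolding S_def using U(1) U' R by (simp add: assoc del: mat_adjoint_carrier)
    also have "\<dots> = U * (diagonal n r * diagonal n r) * mat_adjoint U"
      unfolding U(2) using U(1) U' R by (simp add: assoc left_mult_one_mat[of _ n n])
    also have "\<dots> = (U * mat_adjoint U) * A * (U * mat_adjoint U)"
      unfolding RR d[symmetric] using U(1) Ac(1) by (simp add: assoc)
    finally show ?thesis using UU Ac(1) by simp
  qed
  ultimately show ?thesis using that by blast
qed

text \<open>The difference \<open>X = S - T\<close> is Hermitian and satisfies \<open>S X = - X T\<close>.  In an orthonormal basis that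
  turns \<open>X\<close> into a diagonal matrix \<open>diag d\<close>, and \<open>S\<close>, \<open>T\<close> into \<open>S'\<close>, \<open>T'\<close>, the \<open>i\<close>-th diagonal
  entries of the two sides give \<open>d\<^sub>i (S'\<^sub>i\<^sub>i + T'\<^sub>i\<^sub>i) = 0\<close>.  Diagonal entries of positive definite
  matrices are positive, hence \<open>d = 0\<close>.\<close>
lemma pos_def_sqrt_unique:
  assumes S: "S \<in> pos_def_mats n" and T: "T \<in> pos_def_mats n" and eq: "S * S = T * T"
  shows "S = T"
proof -
  note Sc = pos_def_matsD[OF S] and Tc = pos_def_matsD[OF T]
  define X where "X = S - T"
  have X: "X \<in> carrier_mat n n" using Sc Tc by (auto simp: X_def)
  have Xh: "mat_adjoint X = X"
  proof (rule eq_matI)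
    fix i j assume "i < dim_row X" "j < dim_col X"
    then have ij: "i < n" "j < n" using X by auto
    have "cnj (S $$ (j, i)) = mat_adjoint S $$ (i, j)" "cnj (T $$ (j, i)) = mat_adjoint T $$ (i, j)"
      using Sc(1) Tc(1) ij by auto
    then show "mat_adjoint X $$ (i, j) = X $$ (i, j)" using Sc(1,2) Tc(1,2) ij by (simp add: X_def)
  qed (use X in auto)
  have SX: "S * X = - (X * T)"
  proof -
    have "S * X + X * T = (S * S - S * T) + (S * T - T * T)"
      unfolding X_def using Sc(1) Tc(1)
      by (simp add: mult_minus_distrib_mat[of _ n n _ n] minus_mult_distrib_mat[of _ n n _ _ n])
    also have "\<dots> = 0\<^sub>m n n" using Sc(1) Tc(1) eq by (intro eq_matI) auto
    finally have sum0: "S * X + X * T = 0\<^sub>m n n" .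
    show ?thesis
    proof (rule eq_matI)
      fix i j assume "i < dim_row (- (X * T))" "j < dim_col (- (X * T))"
      then have ij: "i < n" "j < n" using X Tc(1) by auto
      have "(S * X + X * T) $$ (i, j) = 0" using sum0 ij by simp
      moreover have "(S * X + X * T) $$ (i, j) = (S * X) $$ (i, j) + (X * T) $$ (i, j)"
        using ij X Tc(1) by (intro index_add_mat(1)) auto
      ultimately have "(S * X) $$ (i, j) = - (X * T) $$ (i, j)" by (simp only: eq_neg_iff_add_eq_0)
      then show "(S * X) $$ (i, j) = (- (X * T)) $$ (i, j)" using ij X Tc(1) by simp
    qed (use X Sc(1) Tc(1) in auto)
  qed
  obtain U d where U: "U \<in> carrier_mat n n" "mat_adjoint U * U = 1\<^sub>m n"
    and d: "mat_adjoint U * X * U = diagonal n d"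
    using hermitian_unitary_diagonalization[of X n] X Xh by (auto simp: hermitian_mats_def)
  have UU: "U * mat_adjoint U = 1\<^sub>m n"
    using mat_mult_left_right_inverse[OF mat_adjoint_carrier[OF U(1)] U(1,2)] .
  note assoc = assoc_mult_mat[of _ n n _ n _ n] mult_carrier_mat[of _ n n _ n]
  define S' where "S' = mat_adjoint U * S * U"
  define T' where "T' = mat_adjoint U * T * U"
  have S': "S' \<in> pos_def_mats n" and T': "T' \<in> pos_def_mats n"
    unfolding S'_def T'_def
    using pos_def_mats_congruence[OF S U(1) _ U(2)] pos_def_mats_congruence[OF T U(1) _ U(2)] U(1)
    by auto
  \<comment> \<open>Conjugating \<open>S X = - X T\<close> by \<open>U\<close>; inserting \<open>U U\<^sup>H = 1\<close> splits the products.\<close>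
  have "S' * diagonal n d = mat_adjoint U * S * (U * mat_adjoint U) * X * U"
    unfolding S'_def d[symmetric] using U(1) Sc(1) X by (simp add: assoc)
  also have "\<dots> = mat_adjoint U * (S * X) * U" using U(1) Sc(1) X by (simp add: UU assoc)
  also have "\<dots> = - (mat_adjoint U * (X * T) * U)"
    unfolding SX using U(1) Tc(1) X by simp
  also have "mat_adjoint U * (X * T) * U = mat_adjoint U * X * (U * mat_adjoint U) * T * U"
    using U(1) Tc(1) X by (simp add: UU assoc)
  also have "\<dots> = diagonal n d * T'"
    unfolding T'_def d[symmetric] using U(1) Tc(1) X by (simp add: assoc)
  finally have SD: "S' * diagonal n d = - (diagonal n d * T')" .
  have "d i = 0" if i: "i < n" for i
  proof -
    have "(S' * diagonal n d) $$ (i, i) = S' $$ (i, i) * d i"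
      using i pos_def_matsD(1)[OF S']
      by (simp add: diagonal_def scalar_prod_def if_distrib[of "\<lambda>x. _ * x"] cong: if_cong)
    moreover have "(diagonal n d * T') $$ (i, i) = d i * T' $$ (i, i)"
      using i pos_def_matsD(1)[OF T']
      by (simp add: diagonal_def scalar_prod_def if_distrib[of "\<lambda>x. x * _"] cong: if_cong)
    moreover have "(S' * diagonal n d) $$ (i, i) = - ((diagonal n d * T') $$ (i, i))"
      unfolding SD using i pos_def_matsD(1)[OF T'] by (intro index_uminus_mat(1)) auto
    ultimately have "S' $$ (i, i) * d i = - (d i * T' $$ (i, i))" by simp
    then have "d i * (S' $$ (i, i) + T' $$ (i, i)) = 0" by (simp add: algebra_simps)
    moreover have "0 < S' $$ (i, i) + T' $$ (i, i)"
      using pos_def_diag_entry[OF S' i] pos_def_diag_entry[OF T' i] by (rule add_pos_pos)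
    ultimately show ?thesis by auto
  qed
  then have "diagonal n d = 0\<^sub>m n n" by (intro eq_matI) (auto simp: diagonal_def)
  then have "U * (mat_adjoint U * X * U) * mat_adjoint U = 0\<^sub>m n n" using U(1) d by simp
  moreover have "U * (mat_adjoint U * X * U) * mat_adjoint U = (U * mat_adjoint U) * X * (U * mat_adjoint U)"
    using U(1) X by (simp add: assoc)
  ultimately have "X = 0\<^sub>m n n" using UU X by simp
  then have "(S - T) $$ (i, j) = 0" if "i < n" "j < n" for i j
    unfolding X_def[symmetric] using that by simp
  then show ?thesis using Sc(1) Tc(1) by (intro eq_matI) auto
qed

lemma mat_sqrt_pos_def:
  assumes "A \<in> pos_def_mats n"
  shows "mat_sqrt A \<in> pos_def_mats n" "mat_sqrt A * mat_sqrt A = A"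
proof -
  obtain S where "S \<in> pos_def_mats n" "S * S = A" using pos_def_sqrt_exists[OF assms] .
  then have "\<exists>!S. S \<in> pos_def_mats (dim_row A) \<and> S * S = A"
    using pos_def_sqrt_unique pos_def_matsD(1)[OF assms] by (auto intro!: ex1I[of _ S])
  then have "mat_sqrt A \<in> pos_def_mats (dim_row A) \<and> mat_sqrt A * mat_sqrt A = A"
    unfolding mat_sqrt_def by (rule theI')
  then show "mat_sqrt A \<in> pos_def_mats n" "mat_sqrt A * mat_sqrt A = A"
    using pos_def_matsD(1)[OF assms] by auto
qed

section \<open>The Fourier transform of a tensor\<close>

lemma sum_blocks:
  fixes g :: "nat \<Rightarrow> 'a::comm_monoid_add"
  shows "(\<Sum>i<p * n. g i) = (\<Sum>c<p. \<Sum>r<n. g (c * n + r))"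
proof -
  have "sum g {c * n..<c * n + n} = (\<Sum>r<n. g (c * n + r))" for c
    using sum.shift_bounds_nat_ivl[of g 0 "c * n" n] by (simp add: lessThan_atLeast0 add.commute)
  then show ?thesis using sum.nat_group[of g n p] by simp
qed

lemma mat_block_eqI:
  assumes "A \<in> carrier_mat (m * p) (n * q)" "B \<in> carrier_mat (m * p) (n * q)"
    and "\<And>a r b s. a < p \<Longrightarrow> r < m \<Longrightarrow> b < q \<Longrightarrow> s < n \<Longrightarrow>
      A $$ (a * m + r, b * n + s) = B $$ (a * m + r, b * n + s)"
  shows "A = B"
proof (rule eq_matI)
  fix i j assume "i < dim_row B" "j < dim_col B"
  then have ij: "i < m * p" "j < n * q" using assms by auto
  then have "0 < m" "0 < n" by (auto intro: gr0I)
  then have "i div m < p" "i mod m < m" "j div n < q" "j mod n < n"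
    using ij by (auto simp: less_mult_imp_div_less mult.commute)
  from assms(3)[OF this] show "A $$ (i, j) = B $$ (i, j)" by simp
qed (use assms in auto)

lemma tensorsD:
  assumes "\<A> \<in> tensors m n p"
  shows "length \<A> = p" "0 < p \<Longrightarrow> tensor_rows \<A> = m" "0 < p \<Longrightarrow> tensor_cols \<A> = n"
  using assms tensors_nth[OF assms, of 0] by (auto simp: tensors_def)

lemma bcirc_carrier:
  assumes "\<A> \<in> tensors m n p" "0 < p"
  shows "bcirc \<A> \<in> carrier_mat (m * p) (n * p)"
  using tensorsD[OF assms(1)] assms(2) by (simp add: bcirc_def Let_def)

lemma bcirc_index:
  assumes "\<A> \<in> tensors m n p" "a < p" "r < m" "b < p" "s < n"
  shows "bcirc \<A> $$ (a * m + r, b * n + s) = \<A> ! ((a + p - b) mod p) $$ (r, s)"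
  using tensorsD[OF assms(1)] assms block_index_less[of a p r m] block_index_less[of b p s n]
  by (simp add: bcirc_def Let_def)

lemma t_product_closed:
  assumes "\<A> \<in> tensors m n p" "\<B> \<in> tensors n q p" "0 < p"
  shows "\<A> \<star> \<B> \<in> tensors m q p"
  using tensorsD[OF assms(1)] tensorsD[OF assms(2)] assms(3)
  by (auto simp: tensors_def t_product_def t_fold_def t_unfold_def bcirc_def Let_def)

lemma t_product_nth:
  assumes A: "\<A> \<in> tensors m n p" and B: "\<B> \<in> tensors n q p" and k: "k < p" and i: "i < m" and j: "j < q"
  shows "(\<A> \<star> \<B>) ! k $$ (i, j)
    = (\<Sum>l<p. \<Sum>r<n. \<A> ! ((k + p - l) mod p) $$ (i, r) * \<B> ! l $$ (r, j))"
proof -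
  have p: "0 < p" using k by simp
  note Ad = tensorsD[OF A] and Bd = tensorsD[OF B]
  have U: "t_unfold \<B> \<in> carrier_mat (n * p) q" using Bd p by (simp add: t_unfold_def Let_def)
  have lt: "k * m + i < m * p" using block_index_less[OF k i] .
  have "(\<A> \<star> \<B>) ! k $$ (i, j) = (bcirc \<A> * t_unfold \<B>) $$ (k * m + i, j)"
    using Ad U bcirc_carrier[OF A p] k i j p by (simp add: t_product_def t_fold_def Let_def)
  also have "\<dots> = (\<Sum>x<p * n. bcirc \<A> $$ (k * m + i, x) * t_unfold \<B> $$ (x, j))"
    using U bcirc_carrier[OF A p] lt j by (simp add: scalar_prod_def lessThan_atLeast0 mult.commute[of p n])
  also have "\<dots> = (\<Sum>l<p. \<Sum>r<n. bcirc \<A> $$ (k * m + i, l * n + r) * t_unfold \<B> $$ (l * n + r, j))"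
    by (rule sum_blocks)
  also have "\<dots> = (\<Sum>l<p. \<Sum>r<n. \<A> ! ((k + p - l) mod p) $$ (i, r) * \<B> ! l $$ (r, j))"
  proof (intro sum.cong refl)
    fix l r assume "l \<in> {..<p}" "r \<in> {..<n}"
    then have l: "l < p" and r: "r < n" by auto
    have "t_unfold \<B> $$ (l * n + r, j) = \<B> ! l $$ (r, j)"
      using Bd p j r block_index_less[OF l r] by (simp add: t_unfold_def Let_def)
    then show "bcirc \<A> $$ (k * m + i, l * n + r) * t_unfold \<B> $$ (l * n + r, j)
        = \<A> ! ((k + p - l) mod p) $$ (i, r) * \<B> ! l $$ (r, j)"
      using bcirc_index[OF A k i l r] by simp
  qed
  finally show ?thesis .
qed

lemma tensor_eqI:
  assumes "\<A> \<in> tensors m n p" "\<B> \<in> tensors m n p"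
    and "\<And>k r s. k < p \<Longrightarrow> r < m \<Longrightarrow> s < n \<Longrightarrow> \<A> ! k $$ (r, s) = \<B> ! k $$ (r, s)"
  shows "\<A> = \<B>"
proof (rule nth_equalityI)
  show "length \<A> = length \<B>" using assms tensorsD(1) by metis
  fix k assume "k < length \<A>"
  then have k: "k < p" using assms tensorsD(1) by metis
  show "\<A> ! k = \<B> ! k"
    using tensors_nth[OF assms(1) k] tensors_nth[OF assms(2) k] assms(3)[OF k]
    by (intro eq_matI) auto
qed

lemma fourier_slice_carrier:
  assumes "\<A> \<in> tensors m n p" "0 < p"
  shows "fourier_slice \<A> j \<in> carrier_mat m n"
  using tensorsD[OF assms(1)] assms(2) by (simp add: fourier_slice_def)

lemma fourier_slice_index:
  assumes "\<A> \<in> tensors m n p" "0 < p" "r < m" "s < n"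
  shows "fourier_slice \<A> j $$ (r, s) = dft p (\<lambda>k. \<A> ! k $$ (r, s)) j"
  using tensorsD[OF assms(1)] assms by (simp add: fourier_slice_def dft_def)

lemma fourier_slices_inject:
  assumes A: "\<A> \<in> tensors m n p" and B: "\<B> \<in> tensors m n p" and p: "0 < p"
    and eq: "\<And>j. j < p \<Longrightarrow> fourier_slice \<A> j = fourier_slice \<B> j"
  shows "\<A> = \<B>"
proof (rule tensor_eqI[OF A B])
  fix k r s assume k: "k < p" and rs: "r < m" "s < n"
  have "dft p (\<lambda>k. \<A> ! k $$ (r, s)) j = dft p (\<lambda>k. \<B> ! k $$ (r, s)) j" if "j < p" for j
    using eq[OF that] fourier_slice_index[OF A p rs] fourier_slice_index[OF B p rs] by metis
  then have "inverse_dft p (dft p (\<lambda>k. \<A> ! k $$ (r, s))) k = inverse_dft p (dft p (\<lambda>k. \<B> ! k $$ (r, s))) k"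
    unfolding inverse_dft_def by simp
  then show "\<A> ! k $$ (r, s) = \<B> ! k $$ (r, s)" using inverse_dft_dft[OF k] by simp
qed

text \<open>The inverse of the map that sends a tensor to its family of Fourier slices.  It supplies the
  candidates for square roots and inverses, and the test vectors for positive definiteness.\<close>
definition tensor_of_fourier_slices :: "nat \<Rightarrow> nat \<Rightarrow> nat \<Rightarrow> (nat \<Rightarrow> complex mat) \<Rightarrow> tensor" where
  "tensor_of_fourier_slices m n p D =
    map (\<lambda>k. mat m n (\<lambda>(r, s). inverse_dft p (\<lambda>j. D j $$ (r, s)) k)) [0..<p]"

lemma tensor_of_fourier_slices_closed: "tensor_of_fourier_slices m n p D \<in> tensors m n p"
  by (auto simp: tensor_of_fourier_slices_def tensors_def)

lemma fourier_slice_tensor_of_fourier_slices: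
  assumes D: "D j \<in> carrier_mat m n" and j: "j < p"
  shows "fourier_slice (tensor_of_fourier_slices m n p D) j = D j"
proof (rule eq_matI)
  let ?X = "tensor_of_fourier_slices m n p D"
  have p: "0 < p" using j by simp
  note X = tensor_of_fourier_slices_closed[of m n p D]
  show "dim_row (fourier_slice ?X j) = dim_row (D j)" "dim_col (fourier_slice ?X j) = dim_col (D j)"
    using fourier_slice_carrier[OF X p, of j] D by auto
  fix r s assume "r < dim_row (D j)" "s < dim_col (D j)"
  then have rs: "r < m" "s < n" using D by auto
  have "fourier_slice ?X j $$ (r, s) = dft p (inverse_dft p (\<lambda>j. D j $$ (r, s))) j"
    unfolding fourier_slice_index[OF X p rs] dft_def
    using rs by (intro sum.cong) (auto simp: tensor_of_fourier_slices_def)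
  then show "fourier_slice ?X j $$ (r, s) = D j $$ (r, s)" using dft_inverse_dft[OF j] by simp
qed

text \<open>Each entry of a slice of the T-product is a sum over \<open>r\<close> of cyclic convolutions in the slice index.\<close>
lemma fourier_slice_t_product:
  assumes A: "\<A> \<in> tensors m n p" and B: "\<B> \<in> tensors n q p" and p: "0 < p"
  shows "fourier_slice (\<A> \<star> \<B>) j = fourier_slice \<A> j * fourier_slice \<B> j"
proof (rule eq_matI)
  note AB = t_product_closed[OF A B p]
  note c = fourier_slice_carrier[OF A p, of j] fourier_slice_carrier[OF B p, of j]
    fourier_slice_carrier[OF AB p, of j]
  show "dim_row (fourier_slice (\<A> \<star> \<B>) j) = dim_row (fourier_slice \<A> j * fourier_slice \<B> j)"
    "dim_col (fourier_slice (\<A> \<star> \<B>) j) = dim_col (fourier_slice \<A> j * fourier_slice \<B> j)"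
    using c by auto
  fix i s assume "i < dim_row (fourier_slice \<A> j * fourier_slice \<B> j)"
    "s < dim_col (fourier_slice \<A> j * fourier_slice \<B> j)"
  then have i: "i < m" and s: "s < q" using c by auto
  have conv: "dft p (\<lambda>k. \<Sum>l<p. \<A> ! ((k + p - l) mod p) $$ (i, r) * \<B> ! l $$ (r, s)) j
      = dft p (\<lambda>k. \<A> ! k $$ (i, r)) j * dft p (\<lambda>k. \<B> ! k $$ (r, s)) j" for r
    by (rule dft_cyclic_convolution)
  have "fourier_slice (\<A> \<star> \<B>) j $$ (i, s)
      = dft p (\<lambda>k. \<Sum>r<n. \<Sum>l<p. \<A> ! ((k + p - l) mod p) $$ (i, r) * \<B> ! l $$ (r, s)) j"
    unfolding fourier_slice_index[OF AB p i s] dft_def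
    by (intro sum.cong refl arg_cong2[where f = "(*)"])
      (auto simp: t_product_nth[OF A B _ i s] intro: sum.swap)
  also have "\<dots> = (\<Sum>r<n. dft p (\<lambda>k. \<Sum>l<p. \<A> ! ((k + p - l) mod p) $$ (i, r) * \<B> ! l $$ (r, s)) j)"
    unfolding dft_def by (subst sum_distrib_left) (rule sum.swap)
  also have "\<dots> = (\<Sum>r<n. fourier_slice \<A> j $$ (i, r) * fourier_slice \<B> j $$ (r, s))"
    by (intro sum.cong refl)
      (simp add: fourier_slice_index[OF A p i] fourier_slice_index[OF B p _ s] conv)
  also have "\<dots> = (fourier_slice \<A> j * fourier_slice \<B> j) $$ (i, s)"
    using c i s by (simp add: scalar_prod_def lessThan_atLeast0)
  finally show "fourier_slice (\<A> \<star> \<B>) j $$ (i, s) = (fourier_slice \<A> j * fourier_slice \<B> j) $$ (i, s)" .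
qed

lemma t_adjoint_closed:
  assumes "\<A> \<in> tensors m n p" "0 < p"
  shows "t_adjoint \<A> \<in> tensors n m p"
  using tensorsD[OF assms(1)] tensors_nth[OF assms(1)] assms(2)
  by (auto simp: t_adjoint_def tensors_def Let_def)

lemma fourier_slice_t_adjoint:
  assumes A: "\<A> \<in> tensors m n p" and p: "0 < p"
  shows "fourier_slice (t_adjoint \<A>) j = mat_adjoint (fourier_slice \<A> j)"
proof (rule eq_matI)
  note A' = t_adjoint_closed[OF A p]
  note c = fourier_slice_carrier[OF A p, of j] fourier_slice_carrier[OF A' p, of j]
  show "dim_row (fourier_slice (t_adjoint \<A>) j) = dim_row (mat_adjoint (fourier_slice \<A> j))"
    "dim_col (fourier_slice (t_adjoint \<A>) j) = dim_col (mat_adjoint (fourier_slice \<A> j))"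
    using c by auto
  fix r s assume "r < dim_row (mat_adjoint (fourier_slice \<A> j))" "s < dim_col (mat_adjoint (fourier_slice \<A> j))"
  then have rs: "r < n" "s < m" using c by auto
  have "t_adjoint \<A> ! k $$ (r, s) = cnj (\<A> ! ((p - k) mod p) $$ (s, r))" if "k < p" for k
    using that tensorsD(1)[OF A] tensors_nth[OF A, of "(p - k) mod p"] rs p
    by (auto simp: t_adjoint_def Let_def)
  then have "fourier_slice (t_adjoint \<A>) j $$ (r, s) = dft p (\<lambda>k. cnj (\<A> ! ((p - k) mod p) $$ (s, r))) j"
    unfolding fourier_slice_index[OF A' p rs] dft_def by simp
  also have "\<dots> = cnj (fourier_slice \<A> j $$ (s, r))"
    using dft_reversed_cnj[of p "\<lambda>k. \<A> ! k $$ (s, r)"] fourier_slice_index[OF A p rs(2,1)] by simp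
  finally show "fourier_slice (t_adjoint \<A>) j $$ (r, s) = mat_adjoint (fourier_slice \<A> j) $$ (r, s)"
    using c rs by simp
qed

lemma id_tensor_closed: "id_tensor n p \<in> tensors n n p"
  by (auto simp: id_tensor_def tensors_def)

lemma fourier_slice_id_tensor:
  assumes p: "0 < p"
  shows "fourier_slice (id_tensor n p) j = 1\<^sub>m n"
proof (rule eq_matI)
  note I = id_tensor_closed[of n p]
  fix r s assume "r < dim_row (1\<^sub>m n :: complex mat)" "s < dim_col (1\<^sub>m n :: complex mat)"
  then have rs: "r < n" "s < n" by auto
  have "fourier_slice (id_tensor n p) j $$ (r, s)
      = (\<Sum>k<p. if k = 0 then 1\<^sub>m n $$ (r, s) else 0)"
    unfolding fourier_slice_index[OF I p rs] dft_def
    using rs by (intro sum.cong) (auto simp: id_tensor_def)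
  then show "fourier_slice (id_tensor n p) j $$ (r, s) = 1\<^sub>m n $$ (r, s)" using p by simp
qed (use fourier_slice_carrier[OF id_tensor_closed p, of n j] in auto)

lemma zero_tensor_closed: "zero_tensor m n p \<in> tensors m n p"
  by (auto simp: zero_tensor_def tensors_def)

lemma fourier_slice_zero_tensor:
  assumes p: "0 < p"
  shows "fourier_slice (zero_tensor m n p) j = 0\<^sub>m m n"
proof (rule eq_matI)
  note Z = zero_tensor_closed[of m n p]
  fix r s assume "r < dim_row (0\<^sub>m m n :: complex mat)" "s < dim_col (0\<^sub>m m n :: complex mat)"
  then show "fourier_slice (zero_tensor m n p) j $$ (r, s) = 0\<^sub>m m n $$ (r, s)"
    using fourier_slice_index[OF Z p, of r s j] by (simp add: dft_def zero_tensor_def)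
qed (use fourier_slice_carrier[OF zero_tensor_closed p, of m n j] in auto)

section \<open>Positive definiteness slice by slice\<close>

text \<open>Parseval in every row.\<close>
lemma tensor_inner_fourier:
  assumes X: "\<X> \<in> tensors n 1 p" and Y: "\<Y> \<in> tensors n 1 p" and p: "0 < p"
  shows "of_nat p * tensor_inner \<X> \<Y>
    = (\<Sum>j<p. col (fourier_slice \<Y> j) 0 \<bullet>c col (fourier_slice \<X> j) 0)"
proof -
  have ip: "col (fourier_slice \<Y> j) 0 \<bullet>c col (fourier_slice \<X> j) 0
      = (\<Sum>i<n. cnj (dft p (\<lambda>k. \<X> ! k $$ (i, 0)) j) * dft p (\<lambda>k. \<Y> ! k $$ (i, 0)) j)" for j
    using fourier_slice_carrier[OF X p, of j] fourier_slice_carrier[OF Y p, of j]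
      fourier_slice_index[OF X p] fourier_slice_index[OF Y p]
    by (simp add: scalar_prod_def lessThan_atLeast0 mult.commute)
  have "tensor_inner \<X> \<Y> = (\<Sum>i<n. \<Sum>k<p. cnj (\<X> ! k $$ (i, 0)) * \<Y> ! k $$ (i, 0))"
    unfolding tensor_inner_def using tensorsD[OF X] p by (simp add: sum.swap[of _ _ "{..<p}"])
  then have "of_nat p * tensor_inner \<X> \<Y>
      = (\<Sum>i<n. of_nat p * (\<Sum>k<p. cnj (\<X> ! k $$ (i, 0)) * \<Y> ! k $$ (i, 0)))"
    by (simp add: sum_distrib_left)
  also have "\<dots> = (\<Sum>j<p. \<Sum>i<n. cnj (dft p (\<lambda>k. \<X> ! k $$ (i, 0)) j) * dft p (\<lambda>k. \<Y> ! k $$ (i, 0)) j)"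
    unfolding dft_parseval[symmetric] by (rule sum.swap)
  finally show ?thesis unfolding ip .
qed

lemma tensor_inner_t_product_fourier:
  assumes A: "\<A> \<in> tensors n n p" and X: "\<X> \<in> tensors n 1 p" and p: "0 < p"
  shows "of_nat p * tensor_inner \<X> (\<A> \<star> \<X>)
    = (\<Sum>j<p. (fourier_slice \<A> j *\<^sub>v col (fourier_slice \<X> j) 0) \<bullet>c col (fourier_slice \<X> j) 0)"
proof -
  have "col (fourier_slice (\<A> \<star> \<X>) j) 0 = fourier_slice \<A> j *\<^sub>v col (fourier_slice \<X> j) 0" for j
    unfolding fourier_slice_t_product[OF A X p]
    by (rule col_mult2[OF fourier_slice_carrier[OF A p] fourier_slice_carrier[OF X p]]) simp
  then show ?thesis using tensor_inner_fourier[OF X t_product_closed[OF A X p] p] by simp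
qed

lemma complex_of_nat_mult_pos_iff:
  assumes "0 < p" shows "0 < complex_of_nat p * z \<longleftrightarrow> 0 < z"
  using assms by (auto simp: less_complex_def zero_less_mult_iff)

lemma t_hermitian_iff_fourier:
  assumes A: "\<A> \<in> tensors n n p" and p: "0 < p"
  shows "\<A> \<in> t_hermitian n p \<longleftrightarrow> (\<forall>j<p. fourier_slice \<A> j \<in> hermitian_mats n)"
  using fourier_slices_inject[OF t_adjoint_closed[OF A p] A p] A fourier_slice_carrier[OF A p]
  by (auto simp: t_hermitian_def hermitian_mats_def fourier_slice_t_adjoint[OF A p, symmetric])

text \<open>By Parseval, \<open>p \<cdot> \<langle>\<X>, \<A> \<star> \<X>\<rangle>\<close> is the sum over \<open>j\<close> of the quadratic forms of the \<open>j\<close>-th Fourier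
  slice of \<open>\<A>\<close> at the \<open>j\<close>-th Fourier slice of \<open>\<X>\<close>.  The slices of \<open>\<X>\<close> can be prescribed freely;
  prescribing a single nonzero one isolates a single form.\<close>
lemma t_pos_def_iff_fourier:
  assumes A: "\<A> \<in> tensors n n p" and p: "0 < p"
  shows "\<A> \<in> t_pos_def n p \<longleftrightarrow> (\<forall>j<p. fourier_slice \<A> j \<in> pos_def_mats n)"
proof
  assume pd: "\<A> \<in> t_pos_def n p"
  show "\<forall>j<p. fourier_slice \<A> j \<in> pos_def_mats n"
  proof (intro allI impI)
    fix j assume j: "j < p"
    have herm: "fourier_slice \<A> j \<in> hermitian_mats n"
      using pd j t_hermitian_iff_fourier[OF A p] by (auto simp: t_pos_def_def)
    have "0 < (fourier_slice \<A> j *\<^sub>v v) \<bullet>c v" if v: "v \<in> carrier_vec n" "v \<noteq> 0\<^sub>v n" for v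
    proof -
      define D where "D i = (if i = j then mat n 1 (\<lambda>(r, _). v $ r) else 0\<^sub>m n 1)" for i
      define X where "X = tensor_of_fourier_slices n 1 p D"
      have X: "X \<in> tensors n 1 p" unfolding X_def by (rule tensor_of_fourier_slices_closed)
      have FX: "fourier_slice X i = D i" if "i < p" for i
        unfolding X_def by (rule fourier_slice_tensor_of_fourier_slices) (use that in \<open>auto simp: D_def\<close>)
      have col: "col (D i) 0 = (if i = j then v else 0\<^sub>v n)" for i
        using v by (auto simp: D_def)
      have "X \<noteq> zero_tensor n 1 p"
      proof
        assume "X = zero_tensor n 1 p"
        then have "D j = 0\<^sub>m n 1" using FX[OF j] fourier_slice_zero_tensor[OF p] by simp
        then show False using col[of j] v by simp
      qed
      moreover have zero: "(fourier_slice \<A> i *\<^sub>v 0\<^sub>v n) \<bullet> 0\<^sub>v n = 0" for i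
        by (rule scalar_prod_right_zero[OF mult_mat_vec_carrier[OF fourier_slice_carrier[OF A p]]]) simp
      ultimately have "0 < of_nat p * tensor_inner X (\<A> \<star> X)"
        using pd X p by (simp add: t_pos_def_def complex_of_nat_mult_pos_iff)
      also have "\<dots> = (\<Sum>i<p. if i = j then (fourier_slice \<A> j *\<^sub>v v) \<bullet>c v else 0)"
        unfolding tensor_inner_t_product_fourier[OF A X p]
        by (intro sum.cong refl) (use FX col zero in auto)
      also have "\<dots> = (fourier_slice \<A> j *\<^sub>v v) \<bullet>c v" using j by simp
      finally show ?thesis .
    qed
    then show "fourier_slice \<A> j \<in> pos_def_mats n" using herm by (simp add: pos_def_mats_def)
  qed
next
  assume pd: "\<forall>j<p. fourier_slice \<A> j \<in> pos_def_mats n"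
  have "\<A> \<in> t_hermitian n p"
    using pd t_hermitian_iff_fourier[OF A p] by (auto simp: pos_def_mats_def)
  moreover have "0 < tensor_inner X (\<A> \<star> X)"
    if X: "X \<in> tensors n 1 p" and nz: "X \<noteq> zero_tensor n 1 p" for X
  proof -
    let ?x = "\<lambda>j. col (fourier_slice X j) 0"
    have xc: "?x j \<in> carrier_vec n" for j using fourier_slice_carrier[OF X p, of j] by auto
    obtain j where j: "j < p" "fourier_slice X j \<noteq> 0\<^sub>m n 1"
      using fourier_slices_inject[OF X zero_tensor_closed p] nz fourier_slice_zero_tensor[OF p] by metis
    have "?x j \<noteq> 0\<^sub>v n"
    proof
      assume z: "?x j = 0\<^sub>v n"
      have "fourier_slice X j = 0\<^sub>m n 1"
      proof (rule eq_matI)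
        fix r s assume "r < dim_row (0\<^sub>m n 1 :: complex mat)" "s < dim_col (0\<^sub>m n 1 :: complex mat)"
        then show "fourier_slice X j $$ (r, s) = 0\<^sub>m n 1 $$ (r, s)"
          using arg_cong[OF z, of "\<lambda>v. v $ r"] fourier_slice_carrier[OF X p, of j] by simp
      qed (use fourier_slice_carrier[OF X p, of j] in auto)
      then show False using j by simp
    qed
    then have pos: "0 < (fourier_slice \<A> j *\<^sub>v ?x j) \<bullet>c ?x j" using pd j xc pos_def_matsD(3) by blast
    have nonneg: "0 \<le> (fourier_slice \<A> i *\<^sub>v ?x i) \<bullet>c ?x i" if "i < p" for i
    proof (cases "?x i = 0\<^sub>v n")
      case True
      then show ?thesis using mult_mat_vec_carrier[OF fourier_slice_carrier[OF A p] xc, of i i] by simp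
    next
      case False
      then show ?thesis using pd that xc pos_def_matsD(3) by (blast intro: less_imp_le)
    qed
    have "0 < of_nat p * tensor_inner X (\<A> \<star> X)"
      unfolding tensor_inner_t_product_fourier[OF A X p]
      by (rule sum_pos2[of _ j]) (use j pos nonneg in auto)
    then show ?thesis using complex_of_nat_mult_pos_iff[OF p] by simp
  qed
  ultimately show "\<A> \<in> t_pos_def n p" by (simp add: t_pos_def_def)
qed

section \<open>Square roots, inverses and geometric means slice by slice\<close>

lemma t_pos_def_closed: "\<A> \<in> t_pos_def n p \<Longrightarrow> \<A> \<in> tensors n n p"
  by (simp add: t_pos_def_def t_hermitian_def)

lemma fourier_slice_pos_def:
  "\<A> \<in> t_pos_def n p \<Longrightarrow> j < p \<Longrightarrow> fourier_slice \<A> j \<in> pos_def_mats n"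
  using t_pos_def_iff_fourier[OF t_pos_def_closed] by auto

text \<open>The tensor whose Fourier slices are the square roots of those of \<open>\<A>\<close> is a T-positive definite
  square root.  It is the only one, since the slices of any other are positive definite square roots of
  the slices of \<open>\<A>\<close>.\<close>
lemma t_sqrt_fourier:
  assumes A: "\<A> \<in> t_pos_def n p" and p: "0 < p"
  shows "t_sqrt \<A> \<in> t_pos_def n p"
    and "j < p \<Longrightarrow> fourier_slice (t_sqrt \<A>) j = mat_sqrt (fourier_slice \<A> j)"
proof -
  note At = t_pos_def_closed[OF A]
  define S where "S = tensor_of_fourier_slices n n p (\<lambda>j. mat_sqrt (fourier_slice \<A> j))"
  note sq = mat_sqrt_pos_def[OF fourier_slice_pos_def[OF A]]
  have St: "S \<in> tensors n n p" unfolding S_def by (rule tensor_of_fourier_slices_closed)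
  have FS: "fourier_slice S j = mat_sqrt (fourier_slice \<A> j)" if "j < p" for j
    unfolding S_def by (rule fourier_slice_tensor_of_fourier_slices) (use that pos_def_matsD(1)[OF sq(1)] in auto)
  have S: "S \<in> t_pos_def n p" using t_pos_def_iff_fourier[OF St p] FS sq by simp
  have SS: "S \<star> S = \<A>"
    by (rule fourier_slices_inject[OF t_product_closed[OF St St p] At p])
      (simp add: fourier_slice_t_product[OF St St p] FS sq)
  have "t_sqrt \<A> = S" unfolding t_sqrt_def
  proof (rule the_equality)
    show "S \<in> t_pos_def (tensor_rows \<A>) (length \<A>) \<and> S \<star> S = \<A>"
      using S SS tensorsD[OF At] p by simp
    fix T assume "T \<in> t_pos_def (tensor_rows \<A>) (length \<A>) \<and> T \<star> T = \<A>"
    then have T: "T \<in> t_pos_def n p" and TT: "T \<star> T = \<A>" using tensorsD[OF At] p by auto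
    note Tt = t_pos_def_closed[OF T]
    show "T = S"
    proof (rule fourier_slices_inject[OF Tt St p])
      fix j assume j: "j < p"
      have "fourier_slice T j * fourier_slice T j = fourier_slice S j * fourier_slice S j"
        using TT SS fourier_slice_t_product[OF Tt Tt p] fourier_slice_t_product[OF St St p] by metis
      then show "fourier_slice T j = fourier_slice S j"
        using pos_def_sqrt_unique fourier_slice_pos_def[OF T j] fourier_slice_pos_def[OF S j] by blast
    qed
  qed
  then show "t_sqrt \<A> \<in> t_pos_def n p" "j < p \<Longrightarrow> fourier_slice (t_sqrt \<A>) j = mat_sqrt (fourier_slice \<A> j)"
    using S FS by auto
qed

lemma t_inv_fourier:
  assumes A: "\<A> \<in> t_pos_def n p" and p: "0 < p"
  shows "t_inv \<A> \<in> tensors n n p"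
    and "j < p \<Longrightarrow> fourier_slice (t_inv \<A>) j = mat_inv (fourier_slice \<A> j)"
proof -
  note At = t_pos_def_closed[OF A]
  define B where "B = tensor_of_fourier_slices n n p (\<lambda>j. mat_inv (fourier_slice \<A> j))"
  note inv = mat_inv_pos_def[OF fourier_slice_pos_def[OF A]]
  note Ac = fourier_slice_carrier[OF At p]
  have Bt: "B \<in> tensors n n p" unfolding B_def by (rule tensor_of_fourier_slices_closed)
  have FB: "fourier_slice B j = mat_inv (fourier_slice \<A> j)" if "j < p" for j
    unfolding B_def by (rule fourier_slice_tensor_of_fourier_slices) (use that inv(1) in auto)
  have AB: "\<A> \<star> B = id_tensor n p"
    by (rule fourier_slices_inject[OF t_product_closed[OF At Bt p] id_tensor_closed p])
      (simp add: fourier_slice_t_product[OF At Bt p] FB inv fourier_slice_id_tensor[OF p])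
  have BA: "B \<star> \<A> = id_tensor n p"
    by (rule fourier_slices_inject[OF t_product_closed[OF Bt At p] id_tensor_closed p])
      (simp add: fourier_slice_t_product[OF Bt At p] FB inv fourier_slice_id_tensor[OF p])
  have "t_inv \<A> = B" unfolding t_inv_def Let_def
  proof (rule the_equality)
    show "B \<in> tensors (tensor_rows \<A>) (tensor_rows \<A>) (length \<A>)
        \<and> \<A> \<star> B = id_tensor (tensor_rows \<A>) (length \<A>) \<and> B \<star> \<A> = id_tensor (tensor_rows \<A>) (length \<A>)"
      using Bt AB BA tensorsD[OF At] p by simp
    fix C assume "C \<in> tensors (tensor_rows \<A>) (tensor_rows \<A>) (length \<A>)
        \<and> \<A> \<star> C = id_tensor (tensor_rows \<A>) (length \<A>) \<and> C \<star> \<A> = id_tensor (tensor_rows \<A>) (length \<A>)"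
    then have C: "C \<in> tensors n n p" "C \<star> \<A> = id_tensor n p" using tensorsD[OF At] p by auto
    show "C = B"
    proof (rule fourier_slices_inject[OF C(1) Bt p])
      fix j assume j: "j < p"
      note Cc = fourier_slice_carrier[OF C(1) p, of j]
      have CA: "fourier_slice C j * fourier_slice \<A> j = 1\<^sub>m n"
        using C fourier_slice_t_product[OF C(1) At p] fourier_slice_id_tensor[OF p] by metis
      have "fourier_slice C j = fourier_slice C j * (fourier_slice \<A> j * mat_inv (fourier_slice \<A> j))"
        using Cc inv(2)[OF j] by simp
      also have "\<dots> = mat_inv (fourier_slice \<A> j)"
        using assoc_mult_mat[OF Cc Ac[of j] inv(1)[OF j]] CA inv(1)[OF j] by simp
      finally show "fourier_slice C j = fourier_slice B j" using FB[OF j] by simp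
    qed
  qed
  then show "t_inv \<A> \<in> tensors n n p" "j < p \<Longrightarrow> fourier_slice (t_inv \<A>) j = mat_inv (fourier_slice \<A> j)"
    using Bt FB by auto
qed

text \<open>The definition of the mean uses only products, inverses and square roots, all of which act slice by
  slice.  The middle factor \<open>\<A>\<^sup>-\<^sup>1\<^sup>/\<^sup>2 \<star> \<B> \<star> \<A>\<^sup>-\<^sup>1\<^sup>/\<^sup>2\<close> has to be shown T-positive definite for its
  square root to be meaningful; in every slice it is congruent to the slice of \<open>\<B>\<close>.\<close>
lemma t_geometric_mean_fourier:
  assumes A: "\<A> \<in> t_pos_def n p" and B: "\<B> \<in> t_pos_def n p" and p: "0 < p"
  shows "\<A> #\<^sub>t \<B> \<in> tensors n n p"
    and "j < p \<Longrightarrow> fourier_slice (\<A> #\<^sub>t \<B>) j = fourier_slice \<A> j #\<^sub>m fourier_slice \<B> j"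
proof -
  note S = t_sqrt_fourier[OF A p]
  note R = t_inv_fourier[OF S(1) p]
  note St = t_pos_def_closed[OF S(1)] and Bt = t_pos_def_closed[OF B]
  let ?R = "t_inv (t_sqrt \<A>)"
  let ?C = "?R \<star> \<B> \<star> ?R"
  note RBt = t_product_closed[OF R(1) Bt p]
  note Ct = t_product_closed[OF RBt R(1) p]
  have FC: "fourier_slice ?C j = mat_inv (mat_sqrt (fourier_slice \<A> j)) * fourier_slice \<B> j
      * mat_inv (mat_sqrt (fourier_slice \<A> j))" if "j < p" for j
    using that S(2) R(2)
    by (simp add: fourier_slice_t_product[OF RBt R(1) p] fourier_slice_t_product[OF R(1) Bt p])
  have C: "?C \<in> t_pos_def n p"
    unfolding t_pos_def_iff_fourier[OF Ct p]
  proof (intro allI impI)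
    fix j assume j: "j < p"
    let ?S = "mat_sqrt (fourier_slice \<A> j)"
    have Sp: "?S \<in> pos_def_mats n" by (rule mat_sqrt_pos_def(1)[OF fourier_slice_pos_def[OF A j]])
    note inv = mat_inv_pos_def[OF Sp]
    show "fourier_slice ?C j \<in> pos_def_mats n"
      unfolding FC[OF j]
      using pos_def_mats_congruence[OF fourier_slice_pos_def[OF B j] inv(1) pos_def_matsD(1)[OF Sp] inv(2)] inv(4)
      by simp
  qed
  note Q = t_sqrt_fourier[OF C p]
  note Qt = t_pos_def_closed[OF Q(1)]
  note SQt = t_product_closed[OF St Qt p]
  show "\<A> #\<^sub>t \<B> \<in> tensors n n p"
    unfolding t_geometric_mean_def by (rule t_product_closed[OF SQt St p])
  show "fourier_slice (\<A> #\<^sub>t \<B>) j = fourier_slice \<A> j #\<^sub>m fourier_slice \<B> j" if "j < p"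
    unfolding t_geometric_mean_def mat_geometric_mean_def
    using that S(2) Q(2) FC
    by (simp add: fourier_slice_t_product[OF SQt St p] fourier_slice_t_product[OF St Qt p])
qed

section \<open>Block diagonalisation of block circulant matrices\<close>

lemma kronecker_carrier:
  assumes "F \<in> carrier_mat p q" "M \<in> carrier_mat m n"
  shows "F \<otimes>\<^sub>m M \<in> carrier_mat (m * p) (n * q)"
  using assms by (simp add: kronecker_def mult.commute)

lemma kronecker_index:
  assumes "F \<in> carrier_mat p q" "M \<in> carrier_mat m n" "a < p" "r < m" "b < q" "s < n"
  shows "(F \<otimes>\<^sub>m M) $$ (a * m + r, b * n + s) = F $$ (a, b) * M $$ (r, s)"
  using assms block_index_less[of a p r m] block_index_less[of b q s n]
  by (simp add: kronecker_def mult.commute)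

lemma diag_block_mat_carrier:
  assumes "set Ds \<subseteq> carrier_mat m n"
  shows "diag_block_mat Ds \<in> carrier_mat (m * length Ds) (n * length Ds)"
  using assms by (induction Ds) (auto simp: Let_def)

lemma diag_block_mat_index:
  assumes "set Ds \<subseteq> carrier_mat m n" "a < length Ds" "r < m" "b < length Ds" "s < n"
  shows "diag_block_mat Ds $$ (a * m + r, b * n + s) = (if a = b then Ds ! a $$ (r, s) else 0)"
  using assms
proof (induction Ds arbitrary: a b)
  case (Cons D Ds)
  have D: "D \<in> carrier_mat m n" and Ds: "diag_block_mat Ds \<in> carrier_mat (m * length Ds) (n * length Ds)"
    using Cons.prems diag_block_mat_carrier[of Ds m n] by auto
  have lt: "a * m + r < m + m * length Ds" "b * n + s < n + n * length Ds"
    using Cons.prems block_index_less[of a "Suc (length Ds)" r m] block_index_less[of b "Suc (length Ds)" s n]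
    by auto
  have lt': "a' * m + r < m * length Ds" if "a = Suc a'" for a'
    using that Cons.prems block_index_less[of a' "length Ds" r m] by auto
  have lt'': "b' * n + s < n * length Ds" if "b = Suc b'" for b'
    using that Cons.prems block_index_less[of b' "length Ds" s n] by auto
  show ?case
    using D Ds lt lt' lt'' Cons by (cases a; cases b) (auto simp: Let_def)
qed simp

text \<open>The outer factors act on block indices only, so entry \<open>(r, s)\<close> of every block is treated
  separately, as in the product \<open>G diag(\<dots>) F\<close> of \<open>p \<times> p\<close> matrices.\<close>
lemma kronecker_diag_kronecker_index:
  assumes G: "G \<in> carrier_mat p p" and F: "F \<in> carrier_mat p p"
    and Ds: "set Ds \<subseteq> carrier_mat m n" "length Ds = p"
    and a: "a < p" and r: "r < m" and b: "b < p" and s: "s < n"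
  shows "((G \<otimes>\<^sub>m 1\<^sub>m m) * diag_block_mat Ds * (F \<otimes>\<^sub>m 1\<^sub>m n)) $$ (a * m + r, b * n + s)
    = (\<Sum>c<p. G $$ (a, c) * Ds ! c $$ (r, s) * F $$ (c, b))"
proof -
  let ?G = "G \<otimes>\<^sub>m 1\<^sub>m m" and ?F = "F \<otimes>\<^sub>m 1\<^sub>m n" and ?D = "diag_block_mat Ds"
  have Gc: "?G \<in> carrier_mat (m * p) (m * p)" and Fc: "?F \<in> carrier_mat (n * p) (n * p)"
    using kronecker_carrier[OF G one_carrier_mat] kronecker_carrier[OF F one_carrier_mat] by auto
  have Dc: "?D \<in> carrier_mat (m * p) (n * p)" using diag_block_mat_carrier[OF Ds(1)] Ds(2) by simp
  have idx: "a * m + r < m * p" "b * n + s < n * p"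
    using block_index_less[OF a r] block_index_less[OF b s] by auto
  have GD: "(?G * ?D) $$ (a * m + r, c * n + t) = G $$ (a, c) * Ds ! c $$ (r, t)"
    if c: "c < p" and t: "t < n" for c t
  proof -
    have "(?G * ?D) $$ (a * m + r, c * n + t) = (\<Sum>x<p * m. ?G $$ (a * m + r, x) * ?D $$ (x, c * n + t))"
      using Gc Dc idx block_index_less[OF c t]
      by (simp add: scalar_prod_def lessThan_atLeast0 mult.commute[of p m])
    also have "\<dots> = (\<Sum>d<p. \<Sum>u<m. ?G $$ (a * m + r, d * m + u) * ?D $$ (d * m + u, c * n + t))"
      by (rule sum_blocks)
    also have "\<dots> = (\<Sum>d<p. \<Sum>u<m. if u = r then if d = c then G $$ (a, c) * Ds ! c $$ (r, t) else 0 else 0)"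
    proof (intro sum.cong refl)
      fix d u assume "d \<in> {..<p}" "u \<in> {..<m}"
      then have d: "d < p" and u: "u < m" by auto
      show "?G $$ (a * m + r, d * m + u) * ?D $$ (d * m + u, c * n + t)
        = (if u = r then if d = c then G $$ (a, c) * Ds ! c $$ (r, t) else 0 else 0)"
        using kronecker_index[OF G one_carrier_mat a r d u] diag_block_mat_index[OF Ds(1) _ u _ t, of d c]
          Ds(2) c d u r by auto
    qed
    also have "\<dots> = G $$ (a, c) * Ds ! c $$ (r, t)" using r c by simp
    finally show ?thesis .
  qed
  have "(?G * ?D * ?F) $$ (a * m + r, b * n + s)
      = (\<Sum>x<p * n. (?G * ?D) $$ (a * m + r, x) * ?F $$ (x, b * n + s))"
    using Gc Dc Fc idx by (simp add: scalar_prod_def lessThan_atLeast0 mult.commute[of p n] del: assoc_mult_mat)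
  also have "\<dots> = (\<Sum>c<p. \<Sum>t<n. (?G * ?D) $$ (a * m + r, c * n + t) * ?F $$ (c * n + t, b * n + s))"
    by (rule sum_blocks)
  also have "\<dots> = (\<Sum>c<p. \<Sum>t<n. if t = s then G $$ (a, c) * Ds ! c $$ (r, s) * F $$ (c, b) else 0)"
  proof (intro sum.cong refl)
    fix c t assume "c \<in> {..<p}" "t \<in> {..<n}"
    then have c: "c < p" and t: "t < n" by auto
    show "(?G * ?D) $$ (a * m + r, c * n + t) * ?F $$ (c * n + t, b * n + s)
      = (if t = s then G $$ (a, c) * Ds ! c $$ (r, s) * F $$ (c, b) else 0)"
      using kronecker_index[OF F one_carrier_mat c t b s] GD[OF c t] s t by auto
  qed
  also have "\<dots> = (\<Sum>c<p. G $$ (a, c) * Ds ! c $$ (r, s) * F $$ (c, b))" using s by simp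
  finally show ?thesis .
qed

text \<open>Block \<open>(a, b)\<close> of the right-hand side is \<open>1/p \<Sum>\<^sub>c \<omega>\<^sup>-\<^sup>c\<^sup>(\<^sup>a\<^sup>-\<^sup>b\<^sup>) A\<^sub>c\<close> with the Fourier
  slices \<open>A\<^sub>c\<close> of \<open>\<A>\<close>, which Fourier inversion identifies with slice \<open>(a - b) mod p\<close> of \<open>\<A>\<close>.\<close>
theorem bcirc_fourier:
  assumes A: "\<A> \<in> tensors m n p" and p: "0 < p"
  shows "bcirc \<A> = (mat_adjoint (dft_mat p) \<otimes>\<^sub>m 1\<^sub>m m)
    * diag_block_mat (map (fourier_slice \<A>) [0..<p]) * (dft_mat p \<otimes>\<^sub>m 1\<^sub>m n)" (is "_ = ?G * ?D * ?F")
proof (rule mat_block_eqI[of _ m p n p])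
  let ?w = "root_of_unity p"
  have F: "dft_mat p \<in> carrier_mat p p" by (simp add: dft_mat_def)
  have Ds: "set (map (fourier_slice \<A>) [0..<p]) \<subseteq> carrier_mat m n" "length (map (fourier_slice \<A>) [0..<p]) = p"
    using fourier_slice_carrier[OF A p] by auto
  show "bcirc \<A> \<in> carrier_mat (m * p) (n * p)" by (rule bcirc_carrier[OF A p])
  show "?G * ?D * ?F \<in> carrier_mat (m * p) (n * p)"
    using kronecker_carrier[OF mat_adjoint_carrier[OF F] one_carrier_mat, of m]
      kronecker_carrier[OF F one_carrier_mat, of n] diag_block_mat_carrier[OF Ds(1)] Ds(2)
    by (intro mult_carrier_mat) auto
  fix a r b s assume a: "a < p" and r: "r < m" and b: "b < p" and s: "s < n"
  let ?k = "(a + p - b) mod p"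
  have k: "?k < p" using p by simp
  \<comment> \<open>The two factors \<open>1 / \<surd>p\<close> combine, and the exponents differ by \<open>c (a - b)\<close> modulo \<open>p\<close>.\<close>
  have coeff: "mat_adjoint (dft_mat p) $$ (a, c) * dft_mat p $$ (c, b) = cnj (?w ^ (c * ?k)) / of_nat p"
    if c: "c < p" for c
  proof -
    have "?w ^ (c * a) = ?w ^ (c * (?k + b))"
      using mod_shift_inverse(1)[OF a b] p a
      by (intro root_of_unity_power_cong) (metis mod_less mod_mult_right_eq)+
    then have "?w ^ (c * a) = ?w ^ (c * ?k) * ?w ^ (c * b)" by (simp add: power_add distrib_left)
    then have "cnj (?w ^ (c * a)) * ?w ^ (c * b)
        = cnj (?w ^ (c * ?k)) * (cnj (?w ^ (c * b)) * ?w ^ (c * b))"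
      by (simp only: complex_cnj_mult mult.assoc)
    also have "\<dots> = cnj (?w ^ (c * ?k))" unfolding cnj_root_of_unity_power_mult by simp
    finally have w: "cnj (?w ^ (c * a)) * ?w ^ (c * b) = cnj (?w ^ (c * ?k))" .
    have sq: "complex_of_real (sqrt (real p)) * complex_of_real (sqrt (real p)) = of_nat p"
      by (simp flip: of_real_mult)
    have "mat_adjoint (dft_mat p) $$ (a, c) * dft_mat p $$ (c, b)
        = cnj (?w ^ (c * a)) * ?w ^ (c * b)
          / (complex_of_real (sqrt (real p)) * complex_of_real (sqrt (real p)))"
      using a b c by (simp add: dft_mat_def)
    then show ?thesis unfolding w sq .
  qed
  have "(?G * ?D * ?F) $$ (a * m + r, b * n + s)
      = (\<Sum>c<p. (mat_adjoint (dft_mat p) $$ (a, c) * dft_mat p $$ (c, b)) * fourier_slice \<A> c $$ (r, s))"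
    unfolding kronecker_diag_kronecker_index[OF mat_adjoint_carrier[OF F] F Ds a r b s]
    by (intro sum.cong refl) (auto simp: mult_ac)
  also have "\<dots> = inverse_dft p (dft p (\<lambda>k. \<A> ! k $$ (r, s))) ?k"
    unfolding inverse_dft_def sum_divide_distrib
    by (intro sum.cong refl) (simp add: coeff fourier_slice_index[OF A p r s])
  also have "\<dots> = \<A> ! ?k $$ (r, s)" by (rule inverse_dft_dft[OF k])
  also have "\<dots> = bcirc \<A> $$ (a * m + r, b * n + s)" using bcirc_index[OF A a r b s] by simp
  finally show "bcirc \<A> $$ (a * m + r, b * n + s) = (?G * ?D * ?F) $$ (a * m + r, b * n + s)" by simp
qed

section \<open>The geometric mean of tensors\<close>

theorem theorem3p2:
  fixes n p :: nat and \<A> \<B> :: tensor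
  assumes "n > 0" and "p > 0"
    and "\<A> \<in> t_pos_def n p" and "\<B> \<in> t_pos_def n p"
  shows "let M = (mat_adjoint (dft_mat p) \<otimes>\<^sub>m 1\<^sub>m n)
               * diag_block_mat (map (\<lambda>j. fourier_slice \<A> j #\<^sub>m fourier_slice \<B> j) [0..<p])
               * (dft_mat p \<otimes>\<^sub>m 1\<^sub>m n)
         in M \<in> bcirc ` tensors n n p \<and> \<A> #\<^sub>t \<B> = bcirc_inv n n p M"
proof -
  note G = t_geometric_mean_fourier[OF assms(3,4,2)]
  have slices: "map (\<lambda>j. fourier_slice \<A> j #\<^sub>m fourier_slice \<B> j) [0..<p]
      = map (fourier_slice (\<A> #\<^sub>t \<B>)) [0..<p]"
    using G(2) by simp
  have "bcirc_inv n n p (bcirc (\<A> #\<^sub>t \<B>)) = \<A> #\<^sub>t \<B>"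
    unfolding bcirc_inv_def by (rule the_inv_into_f_f[OF inj_on_bcirc G(1)])
  then show ?thesis
    unfolding slices Let_def bcirc_fourier[OF G(1) assms(2), symmetric] using G(1) by simp
qed

end
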